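(* Fix an integer $k\ge 1$, a vector $\mathbf{w}=[w_1,\dots,w_k]^\intercal\in\mathbb{R}^k$ with $w_i\neq 0$ for all $i$, and constants $\sigma_a,\sigma_z>0$. Let $$c(\mathbf{w}) = \min_{\emptyset\neq\mathcal{T}\subseteq[k]}\left[\frac{1}{2|\mathcal{T}|}\log\left(1+\frac{\sigma_a^2}{\sigma_z^2}\sum_{j\in\mathcal{T}}w_j^2\right)\right].$$ Let $(n_m)_{m\ge k}$ be a sequence of positive integers. If $$\limsup_{m\to\infty}\frac{\log m}{n_m}<c(\mathbf{w}),$$ then there exist a sequence of matrices $\{A^{(m)}\}_{m=k}^\infty$, $A^{(m)}\in\mathbb{R}^{n_m\times m}$, and a sequence of support recovery maps $\{d^{(m)}\}_{m=k}^\infty$, $d^{(m)}:\mathbb{R}^{n_m}\to 2^{[m]}$, such that $$\frac{1}{n_m m}\|A^{(m)}\|_F^2\le\sigma_a^2\quad\text{for all } m\ge k$$ and $$\lim_{m\to\infty}\overline{P}_e(\mathbf{w},A^{(m)})=0,$$ where $\overline{P}_e(\mathbf{w},A^{(m)})$ is the average probability of error of $d^{(m)}$.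
   Context: Notation: $[m]=\{1,\dots,m\}$, $2^{[m]}$ is the set of subsets of $[m]$, $\|\cdot\|_F$ is the Frobenius norm. The base of $\log$ is the same everywhere (and is then immaterial). Signal model: for $m\ge k$, $\mathbf{S}=(S_1,\dots,S_k)\in[m]^k$ is chosen uniformly at random from $[m]$ without replacement (uniform over ordered $k$-tuples of distinct elements). The signal $\mathbf{X}=\mathbf{X}(\mathbf{w},\mathbf{S})\in\mathbb{R}^m$ has $X_s=w_j$ if $s=S_j$, and $X_s=0$ if $s\notin\{S_1,\dots,S_k\}$; so $\mathrm{supp}(\mathbf{X})=\{S_1,\dots,S_k\}$. Measurement model: $\mathbf{Y}=A\mathbf{X}+\mathbf{Z}$ with $A\in\mathbb{R}^{n\times m}$ a fixed matrix and $\mathbf{Z}\in\mathbb{R}^n$ having i.i.d. $\mathcal{N}(0,\sigma_z^2)$ entries, independent of $\mathbf{S}$. Here $n=n_m$. A support recovery map is a (Borel measurable) map $d:\mathbb{R}^n\to 2^{[m]}$. Its average probability of error is $\overline{P}_e(\mathbf{w},A)=\mathsf{P}\{d(\mathbf{Y})\neq\mathrm{supp}(\mathbf{X}(\mathbf{w},\mathbf{S}))\}$, the probability being over $\mathbf{S}$ and $\mathbf{Z}$. *)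

theory Defs
  imports "HOL-Probability.Probability"
begin

text \<open>
  Dimensions vary with \<open>m\<close>, so a vector in \<open>\<real>\<^sup>n\<close> is a function \<open>nat \<Rightarrow> real\<close> read on the indices
  \<open>{1..n}\<close>, and an \<open>n \<times> m\<close> matrix is a function \<open>nat \<Rightarrow> nat \<Rightarrow> real\<close> read on \<open>{1..n} \<times> {1..m}\<close>; entries
  outside these ranges are never used. As a measurable space, \<open>\<real>\<^sup>n\<close> with its Borel sets is the
  finite product below, whose points are undefined outside \<open>{1..n}\<close>.
\<close>

abbreviation borel_vec :: "nat \<Rightarrow> (nat \<Rightarrow> real) measure" where
  "borel_vec n \<equiv> Pi\<^sub>M {1..n} (\<lambda>_. borel)"

definition frob_norm :: "nat \<Rightarrow> nat \<Rightarrow> (nat \<Rightarrow> nat \<Rightarrow> real) \<Rightarrow> real" where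
  "frob_norm n m A = L2_set (\<lambda>(i, j). A i j) ({1..n} \<times> {1..m})"

definition distinct_tuples :: "nat \<Rightarrow> nat \<Rightarrow> (nat \<Rightarrow> nat) set" where
  "distinct_tuples k m = {S \<in> {1..k} \<rightarrow>\<^sub>E {1..m}. inj_on S {1..k}}"

text \<open>On \<open>distinct_tuples k m\<close> the index chosen by \<open>inv_into\<close> is the only \<open>j\<close> with \<open>S j = s\<close>.\<close>

definition signal :: "nat \<Rightarrow> (nat \<Rightarrow> real) \<Rightarrow> (nat \<Rightarrow> nat) \<Rightarrow> nat \<Rightarrow> real" where
  "signal k w S s = (if s \<in> S ` {1..k} then w (inv_into {1..k} S s) else 0)"

definition supp :: "nat \<Rightarrow> (nat \<Rightarrow> real) \<Rightarrow> nat set" where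
  "supp m x = {s \<in> {1..m}. x s \<noteq> 0}"

definition measurement ::
  "nat \<Rightarrow> nat \<Rightarrow> (nat \<Rightarrow> nat \<Rightarrow> real) \<Rightarrow> (nat \<Rightarrow> real) \<Rightarrow> (nat \<Rightarrow> real) \<Rightarrow> nat \<Rightarrow> real" where
  "measurement n m A x z = (\<lambda>i\<in>{1..n}. (\<Sum>s=1..m. A i s * x s) + z i)"

definition gaussian_noise :: "nat \<Rightarrow> real \<Rightarrow> (nat \<Rightarrow> real) measure" where
  "gaussian_noise n \<sigma> = Pi\<^sub>M {1..n} (\<lambda>_. density lborel (normal_density 0 \<sigma>))"

text \<open>The joint law of \<open>(S, Z)\<close>; the product measure expresses their independence.\<close>

definition model :: "nat \<Rightarrow> nat \<Rightarrow> nat \<Rightarrow> real \<Rightarrow> ((nat \<Rightarrow> nat) \<times> (nat \<Rightarrow> real)) measure" where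
  "model k m n \<sigma> = uniform_count_measure (distinct_tuples k m) \<Otimes>\<^sub>M gaussian_noise n \<sigma>"

definition recovery_maps :: "nat \<Rightarrow> nat \<Rightarrow> ((nat \<Rightarrow> real) \<Rightarrow> nat set) set" where
  "recovery_maps n m = measurable (borel_vec n) (count_space (Pow {1..m}))"

definition avg_error_prob ::
  "nat \<Rightarrow> nat \<Rightarrow> nat \<Rightarrow> real \<Rightarrow> (nat \<Rightarrow> real) \<Rightarrow> (nat \<Rightarrow> nat \<Rightarrow> real) \<Rightarrow>
    ((nat \<Rightarrow> real) \<Rightarrow> nat set) \<Rightarrow> real" where
  "avg_error_prob k m n \<sigma> w A d =
    \<P>((S, z) in model k m n \<sigma>.
      d (measurement n m A (signal k w S) z) \<noteq> supp m (signal k w S))"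

definition capacity :: "real \<Rightarrow> nat \<Rightarrow> real \<Rightarrow> real \<Rightarrow> (nat \<Rightarrow> real) \<Rightarrow> real" where
  "capacity b k \<sigma>\<^sub>a \<sigma>\<^sub>z w =
    Min ((\<lambda>T. 1 / (2 * real (card T)) * log b (1 + \<sigma>\<^sub>a\<^sup>2 / \<sigma>\<^sub>z\<^sup>2 * (\<Sum>j\<in>T. (w j)\<^sup>2))) `
      {T. T \<noteq> {} \<and> T \<subseteq> {1..k}})"

text \<open>
  The law \<open>model\<close> is a probability measure and the error event of every recovery map is
  measurable, so \<open>avg_error_prob\<close> is a genuine probability.
\<close>

lemma finite_distinct_tuples: "finite (distinct_tuples k m)"
  unfolding distinct_tuples_def by (rule finite_subset[of _ "{1..k} \<rightarrow>\<^sub>E {1..m}"]) (auto intro: finite_PiE)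

lemma distinct_tuples_nonempty:
  assumes "k \<le> m"
  shows "distinct_tuples k m \<noteq> {}"
proof -
  have "restrict id {1..k} \<in> distinct_tuples k m"
    using assms unfolding distinct_tuples_def by (auto simp: inj_on_def)
  then show ?thesis by blast
qed

lemma prob_space_model:
  assumes "k \<le> m" "\<sigma> > 0"
  shows "prob_space (model k m n \<sigma>)"
proof -
  interpret S: prob_space "uniform_count_measure (distinct_tuples k m)"
    using assms by (intro prob_space_uniform_count_measure finite_distinct_tuples distinct_tuples_nonempty)
  interpret Z: prob_space "gaussian_noise n \<sigma>"
    unfolding gaussian_noise_def by (intro prob_space_PiM prob_space_normal_density assms)
  interpret pair_prob_space "uniform_count_measure (distinct_tuples k m)" "gaussian_noise n \<sigma>" ..
  show ?thesis
    unfolding model_def by unfold_locales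
qed

lemma error_event_measurable:
  assumes "d \<in> recovery_maps n m"
  shows "{(S, z) \<in> space (model k m n \<sigma>).
    d (measurement n m A (signal k w S) z) \<noteq> supp m (signal k w S)} \<in> sets (model k m n \<sigma>)"
proof -
  let ?U = "uniform_count_measure (distinct_tuples k m)"
  have sets_model: "sets (model k m n \<sigma>) = sets (count_space (distinct_tuples k m) \<Otimes>\<^sub>M borel_vec n)"
    unfolding model_def gaussian_noise_def
    by (intro sets_pair_measure_cong sets_PiM_cong) (auto simp: sets_uniform_count_measure)
  have space_model: "space (model k m n \<sigma>) = space (count_space (distinct_tuples k m) \<Otimes>\<^sub>M borel_vec n)"
    using sets_model by (rule sets_eq_imp_space_eq)
  have d: "d \<in> borel_vec n \<rightarrow>\<^sub>M count_space (Pow {1..m})"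
    using assms by (simp add: recovery_maps_def)
  have Y: "measurement n m A (signal k w S) \<in> borel_vec n \<rightarrow>\<^sub>M borel_vec n" for S
    unfolding measurement_def by measurable
  have dY: "(\<lambda>z. d (measurement n m A (signal k w S) z)) \<in> borel_vec n \<rightarrow>\<^sub>M count_space (Pow {1..m})" for S
    using measurable_compose[OF Y d] .
  have "(\<lambda>(S, z). d (measurement n m A (signal k w S) z) \<noteq> supp m (signal k w S))
      \<in> count_space (distinct_tuples k m) \<Otimes>\<^sub>M borel_vec n \<rightarrow>\<^sub>M count_space UNIV"
  proof (rule measurable_pair_measure_countable1)
    show "countable (distinct_tuples k m)"
      using finite_distinct_tuples by (rule countable_finite)
    show "(\<lambda>z. case (S, z) of (S, z) \<Rightarrow> d (measurement n m A (signal k w S) z) \<noteq> supp m (signal k w S))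
        \<in> borel_vec n \<rightarrow>\<^sub>M count_space UNIV" for S
      using measurable_compose[OF dY, of "\<lambda>T. T \<noteq> supp m (signal k w S)" "count_space UNIV" S] by simp
  qed
  then have "{x \<in> space (count_space (distinct_tuples k m) \<Otimes>\<^sub>M borel_vec n).
      (case x of (S, z) \<Rightarrow> d (measurement n m A (signal k w S) z) \<noteq> supp m (signal k w S))}
      \<in> sets (count_space (distinct_tuples k m) \<Otimes>\<^sub>M borel_vec n)"
    by (rule predE)
  moreover have "{(S, z) \<in> space (model k m n \<sigma>).
      d (measurement n m A (signal k w S) z) \<noteq> supp m (signal k w S)} =
    {x \<in> space (count_space (distinct_tuples k m) \<Otimes>\<^sub>M borel_vec n).
      (case x of (S, z) \<Rightarrow> d (measurement n m A (signal k w S) z) \<noteq> supp m (signal k w S))}"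
    unfolding space_model by auto
  ultimately show ?thesis
    unfolding sets_model by simp
qed

end

theory Submission
  imports Defs "HOL-Real_Asymp.Real_Asymp"
begin

text \<open>
  Random coding: the entries of \<open>A\<close> are i.i.d. \<open>N(0, \<sigma>\<^sup>2)\<close> with \<open>\<sigma>\<close> slightly below \<open>\<sigma>\<^sub>a\<close>, and the decoder
  intersects the supports of all candidate tuples \<open>S'\<close> whose squared residual is at most
  \<open>n (1 + e) \<sigma>\<^sub>z\<^sup>2\<close>. Let \<open>h\<close> be the difference of the true and the candidate signal and let \<open>v\<close> be the part
  of the residual of \<open>S'\<close> carried by the noise and the columns in the true support. An error forces
  (i) a large noise norm, or (ii) an atypically small \<open>v\<close>, for which only boundedly many patterns of
  \<open>h\<close> on the true support matter, or (iii) a small residual of some wrong \<open>S'\<close> in spite of a typical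
  \<open>v\<close>. Each event is bounded by an exponential that factors over the rows. For (iii) the columns
  outside the true support are integrated out first, and the resulting exponent is at least
  \<open>1/2 ln (1 + \<sigma>\<^sup>2 / \<sigma>\<^sub>z\<^sup>2 \<Sum>j\<in>T. (w j)\<^sup>2)\<close>, up to \<open>O(e)\<close>, where \<open>T\<close> is the set of missed true
  indices; as many indices of \<open>S'\<close> are wrong, so there are only \<open>O(m^|T|)\<close> such candidates. Finally, the
  expected value of (error)/\<open>\<delta>\<close> + (power)/\<open>\<sigma>\<^sub>a\<^sup>2\<close> is below 1 for a suitable \<open>\<delta>\<close> that tends to 0, so one matrix meets
  both requirements.
\<close>

section \<open>Gaussian integrals\<close>

abbreviation gauss :: "real \<Rightarrow> real measure" where
  "gauss \<sigma> \<equiv> density lborel (normal_density 0 \<sigma>)"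

abbreviation gauss_vec :: "nat set \<Rightarrow> real \<Rightarrow> (nat \<Rightarrow> real) measure" where
  "gauss_vec J \<sigma> \<equiv> Pi\<^sub>M J (\<lambda>_. gauss \<sigma>)"

abbreviation gauss_matrix :: "nat \<Rightarrow> nat \<Rightarrow> real \<Rightarrow> (nat \<Rightarrow> nat \<Rightarrow> real) measure" where
  "gauss_matrix n m \<sigma> \<equiv> Pi\<^sub>M {1..n} (\<lambda>_. gauss_vec {1..m} \<sigma>)"

lemma prob_space_gauss_vec: "\<sigma> > 0 \<Longrightarrow> prob_space (gauss_vec J \<sigma>)"
  by (intro prob_space_PiM prob_space_normal_density)

lemma prob_space_gauss_matrix: "\<sigma> > 0 \<Longrightarrow> prob_space (gauss_matrix n m \<sigma>)"
  by (intro prob_space_PiM prob_space_gauss_vec)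

text \<open>Completing the square. The weight \<open>\<beta>\<close> may be negative as long as
  \<open>t\<close> stays positive; the upper-tail bound for the noise uses such a weight.\<close>

lemma normal_density_mult_exp_square:
  fixes \<sigma> \<beta> h c x :: real
  defines "t \<equiv> 1 + 2 * \<beta> * \<sigma>\<^sup>2 * h\<^sup>2"
  assumes "\<sigma> > 0" "t > 0"
  shows "normal_density 0 \<sigma> x * exp (- \<beta> * (c + h * x)\<^sup>2) =
    exp (- \<beta> * c\<^sup>2 / t) / sqrt t * normal_density (- 2 * \<beta> * c * h * \<sigma>\<^sup>2 / t) (\<sigma> / sqrt t) x"
proof -
  define \<mu> where "\<mu> = - 2 * \<beta> * c * h * \<sigma>\<^sup>2 / t"
  have s2: "(\<sigma> / sqrt t)\<^sup>2 = \<sigma>\<^sup>2 / t"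
    using assms by (simp add: power_divide)
  have "- x\<^sup>2 / (2 * \<sigma>\<^sup>2) + - \<beta> * (c + h * x)\<^sup>2 =
      - \<beta> * c\<^sup>2 / t + - (x - \<mu>)\<^sup>2 / (2 * (\<sigma>\<^sup>2 / t))"
  proof -
    have tm: "t * \<mu> = - 2 * \<beta> * c * h * \<sigma>\<^sup>2"
      using assms by (simp add: \<mu>_def)
    \<comment> \<open>After multiplication by \<open>2 * \<sigma>\<^sup>2 * t\<close> the mean
      enters only through \<open>t * \<mu>\<close>, which is free of division, so that a polynomial
      identity remains.\<close>
    have "2 * \<sigma>\<^sup>2 * t * (- x\<^sup>2 / (2 * \<sigma>\<^sup>2) + - \<beta> * (c + h * x)\<^sup>2) =
        - t * x\<^sup>2 - 2 * \<sigma>\<^sup>2 * \<beta> * t * (c + h * x)\<^sup>2"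
      using assms by (simp add: field_simps)
    also have "\<dots> = - 2 * \<sigma>\<^sup>2 * \<beta> * c\<^sup>2 - (t * x - t * \<mu>)\<^sup>2"
      unfolding tm unfolding t_def by (simp add: power2_eq_square algebra_simps)
    also have "\<dots> = 2 * \<sigma>\<^sup>2 * t * (- \<beta> * c\<^sup>2 / t + - (x - \<mu>)\<^sup>2 / (2 * (\<sigma>\<^sup>2 / t)))"
      using \<open>\<sigma> > 0\<close> \<open>t > 0\<close> by (simp add: field_simps power2_eq_square)
    finally show ?thesis
      using assms by simp
  qed
  then have "exp (- x\<^sup>2 / (2 * \<sigma>\<^sup>2)) * exp (- \<beta> * (c + h * x)\<^sup>2) =
      exp (- \<beta> * c\<^sup>2 / t) * exp (- (x - \<mu>)\<^sup>2 / (2 * (\<sigma>\<^sup>2 / t)))"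
    by (simp add: mult_exp_exp)
  moreover have "sqrt (2 * pi * (\<sigma>\<^sup>2 / t)) = sqrt (2 * pi * \<sigma>\<^sup>2) / sqrt t"
    by (simp add: real_sqrt_mult real_sqrt_divide)
  ultimately show ?thesis
    using assms unfolding normal_density_def s2 \<mu>_def[symmetric] by (simp add: field_simps)
qed

lemma nn_integral_gauss_exp_square:
  fixes \<sigma> \<beta> h c :: real
  assumes "\<sigma> > 0" "t = 1 + 2 * \<beta> * \<sigma>\<^sup>2 * h\<^sup>2" "t > 0"
  shows "(\<integral>\<^sup>+x. ennreal (exp (- \<beta> * (c + h * x)\<^sup>2)) \<partial>gauss \<sigma>) =
    ennreal (exp (- \<beta> * c\<^sup>2 / t) / sqrt t)"
proof -
  let ?N = "normal_density (- 2 * \<beta> * c * h * \<sigma>\<^sup>2 / t) (\<sigma> / sqrt t)"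
  have "(\<integral>\<^sup>+x. ennreal (exp (- \<beta> * (c + h * x)\<^sup>2)) \<partial>gauss \<sigma>) =
      (\<integral>\<^sup>+x. ennreal (normal_density 0 \<sigma> x * exp (- \<beta> * (c + h * x)\<^sup>2)) \<partial>lborel)"
    by (subst nn_integral_density) (auto simp: ennreal_mult)
  also have "\<dots> = (\<integral>\<^sup>+x. ennreal (exp (- \<beta> * c\<^sup>2 / t) / sqrt t * ?N x) \<partial>lborel)"
    using normal_density_mult_exp_square[of \<sigma> \<beta> h _ c] assms by simp
  also have "\<dots> = (\<integral>\<^sup>+x. ennreal (exp (- \<beta> * c\<^sup>2 / t) / sqrt t) * ennreal (?N x) \<partial>lborel)"
    using assms by (subst ennreal_mult) auto
  also have "\<dots> = ennreal (exp (- \<beta> * c\<^sup>2 / t) / sqrt t) * (\<integral>\<^sup>+x. ennreal (?N x) \<partial>lborel)"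
    by (rule nn_integral_cmult) simp
  also have "(\<integral>\<^sup>+x. ennreal (?N x) \<partial>lborel) = 1"
    using assms by (subst nn_integral_eq_integral) auto
  finally show ?thesis by simp
qed

text \<open>The linear form is a centred Gaussian with variance
  \<open>\<sigma>\<^sup>2 * (\<Sum>s\<in>J. (h s)\<^sup>2)\<close>, so the one-dimensional formula
  persists. The induction integrates out one coordinate at a time, which changes the weight; hence
  \<open>\<beta>\<close>, \<open>c\<close> and \<open>t\<close> are arbitrary.\<close>

lemma nn_integral_gauss_vec_exp_square:
  fixes \<sigma> \<beta> c :: real and h :: "nat \<Rightarrow> real"
  assumes "finite J" "\<sigma> > 0" "\<beta> \<ge> 0" "t = 1 + 2 * \<beta> * \<sigma>\<^sup>2 * (\<Sum>s\<in>J. (h s)\<^sup>2)"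
  shows "(\<integral>\<^sup>+a. ennreal (exp (- \<beta> * (c + (\<Sum>s\<in>J. h s * a s))\<^sup>2)) \<partial>gauss_vec J \<sigma>) =
    ennreal (exp (- \<beta> * c\<^sup>2 / t) / sqrt t)"
  using assms
proof (induction J arbitrary: c \<beta> t rule: finite_induct)
  case empty
  interpret product_sigma_finite "\<lambda>_. gauss \<sigma>"
    using prob_space_normal_density[OF \<open>\<sigma> > 0\<close>]
    by (intro product_sigma_finite.intro prob_space_imp_sigma_finite)
  show ?case
    using empty by (simp add: PiM_empty nn_integral_count_space_finite)
next
  case (insert j J)
  have sum_upd: "(\<Sum>s\<in>J. h s * (if s = j then y else a s)) = (\<Sum>s\<in>J. h s * a s)" for a y
    using insert.hyps by (intro sum.cong) auto
  interpret product_sigma_finite "\<lambda>_. gauss \<sigma>"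
    using prob_space_normal_density[OF \<open>\<sigma> > 0\<close>]
    by (intro product_sigma_finite.intro prob_space_imp_sigma_finite)
  \<comment> \<open>Integrating out coordinate \<open>j\<close> costs a factor
    \<open>1 / sqrt u\<close> and leaves weight \<open>\<beta> / u\<close> for the others; with
    their factor \<open>v\<close> the total is \<open>t = u * v\<close>.\<close>
  define u where "u = 1 + 2 * \<beta> * \<sigma>\<^sup>2 * (h j)\<^sup>2"
  have u: "u \<ge> 1" using insert.prems by (simp add: u_def)
  have t: "t = u * (1 + 2 * (\<beta> / u) * \<sigma>\<^sup>2 * (\<Sum>s\<in>J. (h s)\<^sup>2))"
  proof -
    have "u * (1 + 2 * (\<beta> / u) * \<sigma>\<^sup>2 * (\<Sum>s\<in>J. (h s)\<^sup>2)) = u + 2 * \<beta> * \<sigma>\<^sup>2 * (\<Sum>s\<in>J. (h s)\<^sup>2)"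
      using u by (simp add: field_simps)
    then show ?thesis
      using insert.hyps insert.prems by (simp add: u_def algebra_simps)
  qed
  define v where "v = 1 + 2 * (\<beta> / u) * \<sigma>\<^sup>2 * (\<Sum>s\<in>J. (h s)\<^sup>2)"
  have v: "v \<ge> 1" unfolding v_def using insert.prems u by (simp add: sum_nonneg)
  have "(\<integral>\<^sup>+a. ennreal (exp (- \<beta> * (c + (\<Sum>s\<in>insert j J. h s * a s))\<^sup>2)) \<partial>gauss_vec (insert j J) \<sigma>) =
     (\<integral>\<^sup>+a. (\<integral>\<^sup>+y. ennreal (exp (- \<beta> * ((c + (\<Sum>s\<in>J. h s * a s)) + h j * y)\<^sup>2)) \<partial>gauss \<sigma>) \<partial>gauss_vec J \<sigma>)"
    using insert.hyps
    by (subst product_nn_integral_insert)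
       (auto intro!: nn_integral_cong simp: algebra_simps sum_upd cong: sum.cong)
  also have "\<dots> = (\<integral>\<^sup>+a. ennreal (exp (- (\<beta> / u) * (c + (\<Sum>s\<in>J. h s * a s))\<^sup>2) / sqrt u) \<partial>gauss_vec J \<sigma>)"
    using u insert.prems by (subst nn_integral_gauss_exp_square[OF _ u_def]) auto
  also have "\<dots> = (\<integral>\<^sup>+a. ennreal (1 / sqrt u) * ennreal (exp (- (\<beta> / u) * (c + (\<Sum>s\<in>J. h s * a s))\<^sup>2)) \<partial>gauss_vec J \<sigma>)"
    using u by (subst ennreal_mult[symmetric]) auto
  also have "\<dots> = ennreal (1 / sqrt u) * (\<integral>\<^sup>+a. ennreal (exp (- (\<beta> / u) * (c + (\<Sum>s\<in>J. h s * a s))\<^sup>2)) \<partial>gauss_vec J \<sigma>)"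
    by (rule nn_integral_cmult) measurable
  also have "\<dots> = ennreal (1 / sqrt u) * ennreal (exp (- (\<beta> / u) * c\<^sup>2 / v) / sqrt v)"
    using insert.prems u by (subst insert.IH[OF _ _ v_def]) auto
  also have "\<dots> = ennreal (exp (- \<beta> * c\<^sup>2 / t) / sqrt t)"
    using u v unfolding t v_def[symmetric]
    by (subst ennreal_mult[symmetric]) (auto simp: real_sqrt_mult)
  finally show ?case .
qed

lemma nn_integral_gauss_square:
  assumes "\<sigma> > 0"
  shows "(\<integral>\<^sup>+x. ennreal (x\<^sup>2) \<partial>gauss \<sigma>) = ennreal (\<sigma>\<^sup>2)"
proof -
  have "(\<integral>\<^sup>+x. ennreal (x\<^sup>2) \<partial>gauss \<sigma>) = (\<integral>\<^sup>+x. ennreal (normal_density 0 \<sigma> x * x\<^sup>2) \<partial>lborel)"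
    by (subst nn_integral_density) (auto simp: ennreal_mult)
  also have "\<dots> = ennreal (\<integral>x. normal_density 0 \<sigma> x * x\<^sup>2 \<partial>lborel)"
    using integrable_normal_moment[of \<sigma> 0 2] assms by (intro nn_integral_eq_integral) auto
  also have "(\<integral>x. normal_density 0 \<sigma> x * x\<^sup>2 \<partial>lborel) = \<sigma>\<^sup>2"
    using integral_normal_moment_even[of \<sigma> 0 1] assms by (simp add: fact_numeral)
  finally show ?thesis .
qed

section \<open>Second moments of the entries of a random matrix\<close>

lemma nn_integral_PiM_component:
  assumes "\<And>i. i \<in> I \<Longrightarrow> prob_space (M i)" "i \<in> I" "f \<in> borel_measurable (M i)"
  shows "(\<integral>\<^sup>+x. f (x i) \<partial>Pi\<^sub>M I M) = (\<integral>\<^sup>+y. f y \<partial>M i)"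
proof -
  have "(\<integral>\<^sup>+y. f y \<partial>M i) = (\<integral>\<^sup>+y. f y \<partial>distr (Pi\<^sub>M I M) (M i) (\<lambda>x. x i))"
    using assms by (subst distr_PiM_component) auto
  also have "\<dots> = (\<integral>\<^sup>+x. f (x i) \<partial>Pi\<^sub>M I M)"
    using assms by (intro nn_integral_distr) auto
  finally show ?thesis ..
qed

lemma measurable_gauss_matrix_entry:
  assumes "i \<in> {1..n}" "s \<in> {1..m}"
  shows "(\<lambda>A. A i s) \<in> borel_measurable (gauss_matrix n m \<sigma>)"
proof -
  have "(\<lambda>A. A i) \<in> gauss_matrix n m \<sigma> \<rightarrow>\<^sub>M gauss_vec {1..m} \<sigma>"
    using assms by (intro measurable_component_singleton)
  moreover have "(\<lambda>a. a s) \<in> gauss_vec {1..m} \<sigma> \<rightarrow>\<^sub>M gauss \<sigma>"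
    using assms by (intro measurable_component_singleton)
  ultimately have "(\<lambda>A. A i s) \<in> gauss_matrix n m \<sigma> \<rightarrow>\<^sub>M gauss \<sigma>"
    by (rule measurable_compose)
  then show ?thesis by simp
qed

lemma frob_norm_square: "(frob_norm n m A)\<^sup>2 = (\<Sum>p\<in>{1..n}\<times>{1..m}. (A (fst p) (snd p))\<^sup>2)"
  unfolding frob_norm_def L2_set_def by (simp add: sum_nonneg case_prod_unfold)

lemma measurable_gauss_matrix_frob_norm:
  "(\<lambda>A. ennreal ((frob_norm n m A)\<^sup>2)) \<in> borel_measurable (gauss_matrix n m \<sigma>)"
  unfolding frob_norm_square
  by (intro measurable_compose[OF _ measurable_ennreal] borel_measurable_sum borel_measurable_power
      measurable_gauss_matrix_entry) (auto simp: mem_Times_iff)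

text \<open>By linearity every entry contributes its second moment. This controls the power
  constraint in expectation.\<close>

lemma nn_integral_gauss_matrix_frob_norm:
  assumes "\<sigma> > 0"
  shows "(\<integral>\<^sup>+A. ennreal ((frob_norm n m A)\<^sup>2) \<partial>gauss_matrix n m \<sigma>) = ennreal (real n * real m * \<sigma>\<^sup>2)"
proof -
  have "(\<integral>\<^sup>+A. ennreal ((frob_norm n m A)\<^sup>2) \<partial>gauss_matrix n m \<sigma>) =
      (\<integral>\<^sup>+A. (\<Sum>p\<in>{1..n}\<times>{1..m}. ennreal ((A (fst p) (snd p))\<^sup>2)) \<partial>gauss_matrix n m \<sigma>)"
    by (simp add: frob_norm_square sum_nonneg)
  also have "\<dots> = (\<Sum>p\<in>{1..n}\<times>{1..m}. \<integral>\<^sup>+A. ennreal ((A (fst p) (snd p))\<^sup>2) \<partial>gauss_matrix n m \<sigma>)"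
    by (rule nn_integral_sum) (auto simp: mem_Times_iff simp del: One_nat_def
      intro!: borel_measurable_power measurable_compose[OF _ measurable_ennreal] measurable_gauss_matrix_entry)
  also have "\<dots> = (\<Sum>p\<in>{1..n}\<times>{1..m}. ennreal (\<sigma>\<^sup>2))"
  proof (rule sum.cong[OF refl])
    fix p assume p: "p \<in> {1..n} \<times> {1..m}"
    then have [measurable]: "(\<lambda>a. a (snd p)) \<in> borel_measurable (gauss_vec {1..m} \<sigma>)"
      using measurable_component_singleton[of "snd p" "{1..m}" "\<lambda>_. gauss \<sigma>"] by (auto simp: mem_Times_iff)
    have "(\<integral>\<^sup>+A. ennreal ((A (fst p) (snd p))\<^sup>2) \<partial>gauss_matrix n m \<sigma>) =
        (\<integral>\<^sup>+a. ennreal ((a (snd p))\<^sup>2) \<partial>gauss_vec {1..m} \<sigma>)"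
      using p assms prob_space_gauss_vec[of \<sigma> "{1..m}"]
      by (intro nn_integral_PiM_component[where f="\<lambda>a. ennreal ((a (snd p))\<^sup>2)"])
         (auto simp: mem_Times_iff simp del: One_nat_def)
    also have "\<dots> = (\<integral>\<^sup>+x. ennreal (x\<^sup>2) \<partial>gauss \<sigma>)"
      using p prob_space_normal_density[OF assms, of 0]
      by (intro nn_integral_PiM_component[where f="\<lambda>x. ennreal (x\<^sup>2)"]) (auto simp: mem_Times_iff)
    finally show "(\<integral>\<^sup>+A. ennreal ((A (fst p) (snd p))\<^sup>2) \<partial>gauss_matrix n m \<sigma>) = ennreal (\<sigma>\<^sup>2)"
      unfolding nn_integral_gauss_square[OF assms] .
  qed
  also have "\<dots> = ennreal (real n * real m * \<sigma>\<^sup>2)"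
    by (simp add: ennreal_mult ennreal_of_nat_eq_real_of_nat)
  finally show ?thesis .
qed

section \<open>Chernoff bounds for one row\<close>

text \<open>Tonelli. Expectations are stated with the row outermost, but are computed by integrating
  over the row first, with the noise in the role of the constant \<open>c\<close>.\<close>

lemma nn_integral_gauss_vec_swap:
  assumes "\<sigma> > 0" "\<tau> > 0" "case_prod f \<in> borel_measurable (gauss_vec J \<sigma> \<Otimes>\<^sub>M gauss \<tau>)"
  shows "(\<integral>\<^sup>+a. (\<integral>\<^sup>+z. f a z \<partial>gauss \<tau>) \<partial>gauss_vec J \<sigma>) = (\<integral>\<^sup>+z. (\<integral>\<^sup>+a. f a z \<partial>gauss_vec J \<sigma>) \<partial>gauss \<tau>)"
proof -
  interpret A: prob_space "gauss_vec J \<sigma>" by (rule prob_space_gauss_vec[OF assms(1)])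
  interpret Z: prob_space "gauss \<tau>" by (rule prob_space_normal_density[OF assms(2)])
  interpret pair_sigma_finite "gauss_vec J \<sigma>" "gauss \<tau>" ..
  show ?thesis using Fubini'[of "f"] assms(3) by simp
qed

text \<open>The exponential moment of \<open>z\<^sup>2 / \<tau>\<^sup>2\<close> at
  \<open>e / 8\<close> is \<open>1 / sqrt (1 - e / 4)\<close>. The outer integral over the row is
  there to match the form in which all rows are combined.\<close>

lemma chernoff_noise_large:
  fixes e :: real
  assumes "\<sigma> > 0" "\<tau> > 0" "0 < e" "e \<le> 1"
  shows "(\<integral>\<^sup>+a. (\<integral>\<^sup>+z. ennreal (exp (e / 8 * (z\<^sup>2 / \<tau>\<^sup>2 - (1 + e)))) \<partial>gauss \<tau>) \<partial>gauss_vec J \<sigma>)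
    \<le> ennreal (exp (- e\<^sup>2 / 16))"
proof -
  interpret A: prob_space "gauss_vec J \<sigma>" by (rule prob_space_gauss_vec[OF assms(1)])
  have "(\<integral>\<^sup>+z. ennreal (exp (e / 8 * (z\<^sup>2 / \<tau>\<^sup>2 - (1 + e)))) \<partial>gauss \<tau>) =
      (\<integral>\<^sup>+z. ennreal (exp (- e / 8 * (1 + e))) * ennreal (exp (- (- e / (8 * \<tau>\<^sup>2)) * (0 + 1 * z)\<^sup>2)) \<partial>gauss \<tau>)"
    by (subst ennreal_mult[symmetric]) (auto simp: mult_exp_exp field_simps)
  also have "\<dots> = ennreal (exp (- e / 8 * (1 + e))) * ennreal (exp (- (- e / (8 * \<tau>\<^sup>2)) * 0\<^sup>2 / (1 - e / 4)) / sqrt (1 - e / 4))"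
    using assms by (subst nn_integral_cmult, simp, subst nn_integral_gauss_exp_square[where t="1 - e / 4"]) auto
  also have "\<dots> = ennreal (exp (- e / 8 * (1 + e)) / sqrt (1 - e / 4))"
    using assms by (subst ennreal_mult[symmetric]) auto
  also have "exp (- e / 8 * (1 + e)) / sqrt (1 - e / 4) = exp (- e / 8 * (1 + e)) * (1 / sqrt (1 - e / 4))"
    by simp
  also have "1 / sqrt (1 - e / 4) = exp (- ln (1 - e / 4) / 2)"
    using assms by (simp add: exp_minus ln_sqrt[symmetric] inverse_eq_divide)
  \<comment> \<open>With \<open>x = e / 4\<close>, the bound
    \<open>- ln (1 - x) \<le> x + 2 * x\<^sup>2\<close> cancels the terms linear in \<open>e\<close>
    and leaves \<open>- e\<^sup>2 / 8 + e\<^sup>2 / 16\<close>.\<close>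
  also have "exp (- e / 8 * (1 + e)) * exp (- ln (1 - e / 4) / 2) \<le> exp (- e\<^sup>2 / 16)"
    using ln_one_minus_pos_lower_bound[of "e / 4"] assms
    by (simp add: mult_exp_exp power2_eq_square field_simps)
  finally show ?thesis
    by (simp add: A.emeasure_space_1 ennreal_leI)
qed

text \<open>The squared Gaussian divided by its variance \<open>V\<close> has exponential moment
  \<open>1 / sqrt (1 + e / 2)\<close> at \<open>- e / 4\<close>; then
  \<open>ln (1 + x) \<ge> x - x\<^sup>2\<close> at \<open>x = e / 2\<close> gives the
  exponent.\<close>

lemma chernoff_output_small:
  fixes e :: real and h :: "nat \<Rightarrow> real"
  assumes "\<sigma> > 0" "\<tau> > 0" "0 < e" "e \<le> 1" "finite J" "K \<subseteq> J"
  defines "V \<equiv> \<sigma>\<^sup>2 * (\<Sum>s\<in>K. (h s)\<^sup>2) + \<tau>\<^sup>2"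
  shows "(\<integral>\<^sup>+a. (\<integral>\<^sup>+z. ennreal (exp (e / 4 * ((1 - e) - (z + (\<Sum>s\<in>K. h s * a s))\<^sup>2 / V))) \<partial>gauss \<tau>) \<partial>gauss_vec J \<sigma>)
    \<le> ennreal (exp (- e\<^sup>2 / 8))"
proof -
  \<comment> \<open>Extension of \<open>h\<close> by zero from \<open>K\<close> to \<open>J\<close>,
    so that the linear form lives on all coordinates of the row.\<close>
  define g where "g s = (if s \<in> K then h s else 0)" for s
  define \<beta> where "\<beta> = e / (4 * V)"
  have V: "V > 0" unfolding V_def using assms by (intro add_nonneg_pos mult_nonneg_nonneg sum_nonneg) auto
  have lin: "(\<Sum>s\<in>K. h s * a s) = (\<Sum>s\<in>J. g s * a s)" for a
    unfolding g_def using assms by (intro sum.mono_neutral_cong_left) auto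
  have sq: "(\<Sum>s\<in>K. (h s)\<^sup>2) = (\<Sum>s\<in>J. (g s)\<^sup>2)"
    unfolding g_def using assms by (intro sum.mono_neutral_cong_left) auto
  define t where "t = 1 + 2 * \<beta> * \<sigma>\<^sup>2 * (\<Sum>s\<in>J. (g s)\<^sup>2)"
  define u where "u = 1 + 2 * (\<beta> / t) * \<tau>\<^sup>2 * 1\<^sup>2"
  have \<beta>: "\<beta> > 0" using assms V by (simp add: \<beta>_def)
  have t: "t \<ge> 1" unfolding t_def using \<beta> by (simp add: sum_nonneg)
  have u: "u \<ge> 1" unfolding u_def using \<beta> t by simp
  \<comment> \<open>The factors \<open>t\<close> from the row and \<open>u\<close> from the noise
    multiply to that of a single Gaussian of variance \<open>V\<close>.\<close>
  have tu: "t * u = 1 + e / 2"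
  proof -
    have "t * u = 1 + 2 * \<beta> * V"
      using t unfolding u_def V_def sq by (simp add: field_simps) (simp add: t_def field_simps)
    then show ?thesis using V by (simp add: \<beta>_def)
  qed
  have "(\<integral>\<^sup>+a. (\<integral>\<^sup>+z. ennreal (exp (e / 4 * ((1 - e) - (z + (\<Sum>s\<in>K. h s * a s))\<^sup>2 / V))) \<partial>gauss \<tau>) \<partial>gauss_vec J \<sigma>)
      = (\<integral>\<^sup>+z. (\<integral>\<^sup>+a. ennreal (exp (e / 4 * ((1 - e) - (z + (\<Sum>s\<in>K. h s * a s))\<^sup>2 / V))) \<partial>gauss_vec J \<sigma>) \<partial>gauss \<tau>)"
    unfolding lin using assms by (intro nn_integral_gauss_vec_swap) measurable
  also have "\<dots> = (\<integral>\<^sup>+z. (\<integral>\<^sup>+a. ennreal (exp (e / 4 * (1 - e))) * ennreal (exp (- \<beta> * (z + (\<Sum>s\<in>J. g s * a s))\<^sup>2)) \<partial>gauss_vec J \<sigma>) \<partial>gauss \<tau>)"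
  proof -
    have "e / 4 * ((1 - e) - x / V) = e / 4 * (1 - e) + - \<beta> * x" for x
      using V by (simp add: \<beta>_def field_simps)
    then show ?thesis
      unfolding lin by (simp only: exp_add) (simp add: ennreal_mult)
  qed
  also have "\<dots> = (\<integral>\<^sup>+z. ennreal (exp (e / 4 * (1 - e))) * ennreal (exp (- \<beta> * z\<^sup>2 / t) / sqrt t) \<partial>gauss \<tau>)"
    using assms \<beta> by (subst nn_integral_cmult, measurable, subst nn_integral_gauss_vec_exp_square[OF _ _ _ t_def]) auto
  also have "\<dots> = (\<integral>\<^sup>+z. ennreal (exp (e / 4 * (1 - e)) / sqrt t) * ennreal (exp (- (\<beta> / t) * (0 + 1 * z)\<^sup>2)) \<partial>gauss \<tau>)"
    using t by (subst (1 2) ennreal_mult[symmetric]) auto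
  also have "\<dots> = ennreal (exp (e / 4 * (1 - e)) / sqrt t) * ennreal (exp (- (\<beta> / t) * 0\<^sup>2 / u) / sqrt u)"
    using assms u by (subst nn_integral_cmult, simp, subst nn_integral_gauss_exp_square[OF _ u_def]) auto
  also have "\<dots> = ennreal (exp (e / 4 * (1 - e)) * (1 / sqrt (t * u)))"
    using t u by (subst ennreal_mult[symmetric]) (auto simp: real_sqrt_mult)
  also have "1 / sqrt (t * u) = exp (- ln (1 + e / 2) / 2)"
    unfolding tu using assms by (simp add: exp_minus ln_sqrt[symmetric] inverse_eq_divide)
  also have "exp (e / 4 * (1 - e)) * exp (- ln (1 + e / 2) / 2) \<le> exp (- e\<^sup>2 / 8)"
    using ln_one_plus_pos_lower_bound[of "e / 2"] assms
    by (simp add: mult_exp_exp power2_eq_square field_simps)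
  finally show ?thesis by (simp add: ennreal_leI)
qed

text \<open>The weight of \<open>(z + \<Sum>s\<in>K. h s * a s)\<^sup>2\<close> is chosen so that the integral over the coordinates
  outside \<open>K\<close> cancels it exactly; what remains is compared through \<open>ln x \<le> x - 1\<close>.\<close>

lemma chernoff_wrong_candidate:
  fixes e :: real and h :: "nat \<Rightarrow> real"
  assumes "\<sigma> > 0" "\<tau> > 0" "0 < e" "e < 1" "finite J" "K \<subseteq> J"
  defines "V \<equiv> \<sigma>\<^sup>2 * (\<Sum>s\<in>K. (h s)\<^sup>2) + \<tau>\<^sup>2"
    and "t \<equiv> 1 + \<sigma>\<^sup>2 / \<tau>\<^sup>2 * (\<Sum>s\<in>J - K. (h s)\<^sup>2)"
  shows "(\<integral>\<^sup>+a. (\<integral>\<^sup>+z. ennreal (exp (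
        ((1 + e) * \<tau>\<^sup>2 - (z + (\<Sum>s\<in>J. h s * a s))\<^sup>2) / (2 * \<tau>\<^sup>2)
        + ((z + (\<Sum>s\<in>K. h s * a s))\<^sup>2 - (1 - e) * V) / (2 * \<tau>\<^sup>2 * t))) \<partial>gauss \<tau>) \<partial>gauss_vec J \<sigma>)
    \<le> ennreal (exp ((e - ln (1 - e) - ln (V / \<tau>\<^sup>2)) / 2))"
proof -
  interpret P: product_sigma_finite "\<lambda>_::nat. gauss \<sigma>"
    using prob_space_normal_density[OF \<open>\<sigma> > 0\<close>]
    by (intro product_sigma_finite.intro prob_space_imp_sigma_finite)
  interpret K: prob_space "gauss_vec K \<sigma>" by (rule prob_space_gauss_vec[OF assms(1)])
  interpret Z: prob_space "gauss \<tau>" by (rule prob_space_normal_density[OF assms(2)])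
  define C where "C = (1 + e) / 2 - (1 - e) * V / (2 * \<tau>\<^sup>2 * t)"
  have fK: "finite K" using assms finite_subset by blast
  have V: "V > 0" unfolding V_def using assms by (intro add_nonneg_pos mult_nonneg_nonneg sum_nonneg) auto
  have t: "t \<ge> 1" unfolding t_def by (simp add: sum_nonneg)
  have split: "(\<Sum>s\<in>J. h s * a s) = (\<Sum>s\<in>K. h s * a s) + (\<Sum>s\<in>J - K. h s * a s)" for a
    using assms by (simp add: sum.subset_diff add.commute)
  define f where "f a z = ennreal (exp (
        ((1 + e) * \<tau>\<^sup>2 - (z + (\<Sum>s\<in>J. h s * a s))\<^sup>2) / (2 * \<tau>\<^sup>2)
        + ((z + (\<Sum>s\<in>K. h s * a s))\<^sup>2 - (1 - e) * V) / (2 * \<tau>\<^sup>2 * t)))" for a z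
  have lin: "(\<Sum>s\<in>K. h s * a s) = (\<Sum>s\<in>J. (if s \<in> K then h s else 0) * a s)" for a
    using assms by (intro sum.mono_neutral_cong_left) auto
  have f_meas: "(\<lambda>a. f a z) \<in> borel_measurable (gauss_vec J \<sigma>)" for z
    unfolding f_def lin by measurable
  have inner: "(\<integral>\<^sup>+a. f a z \<partial>gauss_vec J \<sigma>) = ennreal (exp C / sqrt t)" for z
  proof -
    have "(\<integral>\<^sup>+a. f a z \<partial>gauss_vec J \<sigma>) = (\<integral>\<^sup>+a. f a z \<partial>gauss_vec (K \<union> (J - K)) \<sigma>)"
      using assms by (simp add: Un_absorb1)
    \<comment> \<open>The row splits into independent parts on \<open>K\<close> and
      \<open>J - K\<close>; the second is integrated first, with the first part and the noise held
      fixed.\<close>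
    also have "\<dots> = (\<integral>\<^sup>+x. (\<integral>\<^sup>+y. f (merge K (J - K) (x, y)) z \<partial>gauss_vec (J - K) \<sigma>) \<partial>gauss_vec K \<sigma>)"
      using \<open>finite J\<close> \<open>K \<subseteq> J\<close> fK f_meas by (intro P.product_nn_integral_fold) (auto simp: Un_absorb1)
    also have "\<dots> = (\<integral>\<^sup>+x. (\<integral>\<^sup>+y. ennreal (exp (C + (z + (\<Sum>s\<in>K. h s * x s))\<^sup>2 / (2 * \<tau>\<^sup>2 * t)))
         * ennreal (exp (- (1 / (2 * \<tau>\<^sup>2)) * ((z + (\<Sum>s\<in>K. h s * x s)) + (\<Sum>s\<in>J - K. h s * y s))\<^sup>2)) \<partial>gauss_vec (J - K) \<sigma>) \<partial>gauss_vec K \<sigma>)"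
    proof (intro nn_integral_cong)
      fix x y
      have 1: "(\<Sum>s\<in>K. h s * merge K (J - K) (x, y) s) = (\<Sum>s\<in>K. h s * x s)"
        and 2: "(\<Sum>s\<in>J - K. h s * merge K (J - K) (x, y) s) = (\<Sum>s\<in>J - K. h s * y s)"
        by (auto intro!: sum.cong simp: merge_def)
      show "f (merge K (J - K) (x, y)) z = ennreal (exp (C + (z + (\<Sum>s\<in>K. h s * x s))\<^sup>2 / (2 * \<tau>\<^sup>2 * t)))
         * ennreal (exp (- (1 / (2 * \<tau>\<^sup>2)) * ((z + (\<Sum>s\<in>K. h s * x s)) + (\<Sum>s\<in>J - K. h s * y s))\<^sup>2))"
        unfolding f_def split 1 2 C_def using assms(2) t
        by (subst ennreal_mult[symmetric]) (auto simp: mult_exp_exp diff_divide_distrib add_divide_distrib algebra_simps)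
    qed
    also have "\<dots> = (\<integral>\<^sup>+x. ennreal (exp C / sqrt t) \<partial>gauss_vec K \<sigma>)"
    proof (intro nn_integral_cong)
      fix x
      have "(\<integral>\<^sup>+y. ennreal (exp (C + (z + (\<Sum>s\<in>K. h s * x s))\<^sup>2 / (2 * \<tau>\<^sup>2 * t)))
         * ennreal (exp (- (1 / (2 * \<tau>\<^sup>2)) * ((z + (\<Sum>s\<in>K. h s * x s)) + (\<Sum>s\<in>J - K. h s * y s))\<^sup>2)) \<partial>gauss_vec (J - K) \<sigma>)
        = ennreal (exp (C + (z + (\<Sum>s\<in>K. h s * x s))\<^sup>2 / (2 * \<tau>\<^sup>2 * t)))
         * ennreal (exp (- (1 / (2 * \<tau>\<^sup>2)) * (z + (\<Sum>s\<in>K. h s * x s))\<^sup>2 / t) / sqrt t)"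
        using assms
        by (subst nn_integral_cmult, measurable, subst nn_integral_gauss_vec_exp_square[where t=t]) (auto simp: t_def)
      also have "\<dots> = ennreal (exp C / sqrt t)"
        using t by (subst ennreal_mult[symmetric]) (auto simp: mult_exp_exp)
      finally show "(\<integral>\<^sup>+y. ennreal (exp (C + (z + (\<Sum>s\<in>K. h s * x s))\<^sup>2 / (2 * \<tau>\<^sup>2 * t)))
         * ennreal (exp (- (1 / (2 * \<tau>\<^sup>2)) * ((z + (\<Sum>s\<in>K. h s * x s)) + (\<Sum>s\<in>J - K. h s * y s))\<^sup>2)) \<partial>gauss_vec (J - K) \<sigma>)
        = ennreal (exp C / sqrt t)" .
    qed
    also have "\<dots> = ennreal (exp C / sqrt t)"
      by (simp add: K.emeasure_space_1)
    finally show ?thesis .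
  qed
  have "(\<integral>\<^sup>+a. (\<integral>\<^sup>+z. f a z \<partial>gauss \<tau>) \<partial>gauss_vec J \<sigma>) = (\<integral>\<^sup>+z. (\<integral>\<^sup>+a. f a z \<partial>gauss_vec J \<sigma>) \<partial>gauss \<tau>)"
    unfolding f_def lin using assms(1,2) by (intro nn_integral_gauss_vec_swap) measurable
  also have "\<dots> = ennreal (exp C * (1 / sqrt t))"
    using Z.emeasure_space_1 unfolding inner by simp
  also have "1 / sqrt t = exp (- ln t / 2)"
    using t by (simp add: exp_minus ln_sqrt[symmetric] inverse_eq_divide)
  also have "exp C * exp (- ln t / 2) \<le> exp ((e - ln (1 - e) - ln (V / \<tau>\<^sup>2)) / 2)"
  proof -
    define q where "q = V / \<tau>\<^sup>2"
    have q: "q > 0" using V assms by (simp add: q_def)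
    \<comment> \<open>Here \<open>C = (1 + e) / 2 - x / 2\<close>. In
      \<open>ln x \<le> x - 1\<close> the term \<open>ln t\<close> absorbs the factor
      \<open>1 / sqrt t\<close>, so the coefficients outside \<open>K\<close> vanish from the
      bound.\<close>
    define x where "x = (1 - e) * q / t"
    have "ln x \<le> x - 1"
      using q t assms by (intro ln_le_minus_one) (auto simp: x_def)
    moreover have "ln x = ln (1 - e) + ln q - ln t"
      using q t assms by (simp add: x_def ln_mult ln_div)
    moreover have "C = (1 + e) / 2 - x / 2"
      by (simp add: C_def q_def x_def field_simps)
    ultimately have "C + - ln t / 2 \<le> (e - ln (1 - e) - ln q) / 2"
      by (simp add: field_simps)
    then show ?thesis
      unfolding q_def[symmetric] by (simp add: mult_exp_exp)
  qed
  finally show ?thesis unfolding f_def by (simp add: ennreal_leI)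
qed

text \<open>The pairs of row and noise coordinate are independent and identically distributed, and
  the exponential of a sum is a product, so the bound for one row is raised to the power
  \<open>n\<close>.\<close>

lemma nn_integral_gauss_rows:
  fixes f :: "(nat \<Rightarrow> real) \<Rightarrow> real \<Rightarrow> real"
  assumes "\<sigma> > 0" "\<tau> > 0" "c \<ge> 0"
    and f: "case_prod f \<in> borel_measurable (gauss_vec {1..m} \<sigma> \<Otimes>\<^sub>M gauss \<tau>)"
    and le: "(\<integral>\<^sup>+a. (\<integral>\<^sup>+z. ennreal (exp (f a z)) \<partial>gauss \<tau>) \<partial>gauss_vec {1..m} \<sigma>) \<le> ennreal c"
  shows "(\<integral>\<^sup>+A. (\<integral>\<^sup>+z. ennreal (exp (\<Sum>i=1..n. f (A i) (z i))) \<partial>gaussian_noise n \<tau>) \<partial>gauss_matrix n m \<sigma>)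
    \<le> ennreal (c ^ n)"
proof -
  interpret Z: product_sigma_finite "\<lambda>_::nat. gauss \<tau>"
    using prob_space_normal_density[OF \<open>\<tau> > 0\<close>]
    by (intro product_sigma_finite.intro prob_space_imp_sigma_finite)
  interpret A: product_sigma_finite "\<lambda>_::nat. gauss_vec {1..m} \<sigma>"
    using prob_space_gauss_vec[OF \<open>\<sigma> > 0\<close>]
    by (intro product_sigma_finite.intro prob_space_imp_sigma_finite)
  interpret Z1: prob_space "gauss \<tau>" by (rule prob_space_normal_density[OF assms(2)])
  note f[measurable]
  have fz: "f a \<in> borel_measurable (gauss \<tau>)" if "a \<in> space (gauss_vec {1..m} \<sigma>)" for a
    using measurable_compose[OF measurable_Pair1'[OF that, of "gauss \<tau>"] f] by simp
  have fm: "(\<lambda>a. \<integral>\<^sup>+z. ennreal (exp (f a z)) \<partial>gauss \<tau>) \<in> borel_measurable (gauss_vec {1..m} \<sigma>)"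
    by measurable
  have "(\<integral>\<^sup>+A. (\<integral>\<^sup>+z. ennreal (exp (\<Sum>i=1..n. f (A i) (z i))) \<partial>gaussian_noise n \<tau>) \<partial>gauss_matrix n m \<sigma>) =
      (\<integral>\<^sup>+A. (\<integral>\<^sup>+z. (\<Prod>i\<in>{1..n}. ennreal (exp (f (A i) (z i)))) \<partial>gaussian_noise n \<tau>) \<partial>gauss_matrix n m \<sigma>)"
    by (simp add: exp_sum prod_ennreal)
  also have "\<dots> = (\<integral>\<^sup>+A. (\<Prod>i\<in>{1..n}. \<integral>\<^sup>+z. ennreal (exp (f (A i) z)) \<partial>gauss \<tau>) \<partial>gauss_matrix n m \<sigma>)"
  proof (intro nn_integral_cong)
    fix A assume "A \<in> space (gauss_matrix n m \<sigma>)"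
    then have "f (A i) \<in> borel_measurable (gauss \<tau>)" if "i \<in> {1..n}" for i
      using that by (intro fz) (auto simp: space_PiM)
    then show "(\<integral>\<^sup>+z. (\<Prod>i\<in>{1..n}. ennreal (exp (f (A i) (z i)))) \<partial>gaussian_noise n \<tau>) =
        (\<Prod>i\<in>{1..n}. \<integral>\<^sup>+z. ennreal (exp (f (A i) z)) \<partial>gauss \<tau>)"
      unfolding gaussian_noise_def
      by (intro Z.product_nn_integral_prod[where f="\<lambda>i x. ennreal (exp (f (A i) x))"]) auto
  qed
  also have "\<dots> = (\<Prod>i\<in>{1..n}. \<integral>\<^sup>+a. (\<integral>\<^sup>+z. ennreal (exp (f a z)) \<partial>gauss \<tau>) \<partial>gauss_vec {1..m} \<sigma>)"
    using fm by (intro A.product_nn_integral_prod[where f="\<lambda>i a. \<integral>\<^sup>+z. ennreal (exp (f a z)) \<partial>gauss \<tau>"]) auto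
  also have "\<dots> \<le> ennreal c ^ n"
    using power_mono[OF le, of n] by simp
  also have "\<dots> = ennreal (c ^ n)"
    using assms by (simp add: ennreal_power)
  finally show ?thesis .
qed

section \<open>The decoder\<close>

lemma measurable_gauss_rows:
  fixes f :: "(nat \<Rightarrow> real) \<Rightarrow> real \<Rightarrow> real"
  assumes "case_prod f \<in> borel_measurable (gauss_vec {1..m} \<sigma> \<Otimes>\<^sub>M gauss \<tau>)"
  shows "(\<lambda>(A, z). ennreal (exp (\<Sum>i=1..n. f (A i) (z i)))) \<in>
    borel_measurable (gauss_matrix n m \<sigma> \<Otimes>\<^sub>M gaussian_noise n \<tau>)"
proof -
  have "(\<lambda>(A, z). f (A i) (z i)) \<in> borel_measurable (gauss_matrix n m \<sigma> \<Otimes>\<^sub>M gaussian_noise n \<tau>)"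
    if "i \<in> {1..n}" for i
  proof -
    have "(\<lambda>A. A i) \<in> gauss_matrix n m \<sigma> \<rightarrow>\<^sub>M gauss_vec {1..m} \<sigma>"
      using that by (intro measurable_component_singleton)
    moreover have "(\<lambda>z. z i) \<in> gaussian_noise n \<tau> \<rightarrow>\<^sub>M gauss \<tau>"
      unfolding gaussian_noise_def using that by (intro measurable_component_singleton)
    ultimately have "(\<lambda>p. (fst p i, snd p i)) \<in>
        gauss_matrix n m \<sigma> \<Otimes>\<^sub>M gaussian_noise n \<tau> \<rightarrow>\<^sub>M gauss_vec {1..m} \<sigma> \<Otimes>\<^sub>M gauss \<tau>"
      by (intro measurable_Pair) (auto intro: measurable_compose[OF measurable_fst] measurable_compose[OF measurable_snd])
    from measurable_compose[OF this assms] show ?thesis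
      by (simp add: case_prod_unfold)
  qed
  then show ?thesis
    unfolding case_prod_unfold by (intro measurable_compose[OF _ measurable_ennreal] borel_measurable_exp borel_measurable_sum) auto
qed

definition residual :: "nat \<Rightarrow> nat \<Rightarrow> nat \<Rightarrow> (nat \<Rightarrow> real) \<Rightarrow> (nat \<Rightarrow> nat \<Rightarrow> real) \<Rightarrow>
    (nat \<Rightarrow> nat) \<Rightarrow> (nat \<Rightarrow> real) \<Rightarrow> real" where
  "residual k m n w A S y = (\<Sum>i=1..n. (y i - (\<Sum>s=1..m. A i s * signal k w S s))\<^sup>2)"

text \<open>Intersecting avoids a choice among the passing candidates. If none passes, the value is
  \<open>{1..m}\<close>.\<close>

definition support_decoder :: "nat \<Rightarrow> nat \<Rightarrow> nat \<Rightarrow> (nat \<Rightarrow> real) \<Rightarrow> real \<Rightarrow>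
    (nat \<Rightarrow> nat \<Rightarrow> real) \<Rightarrow> (nat \<Rightarrow> real) \<Rightarrow> nat set" where
  "support_decoder k m n w r A y =
    {s \<in> {1..m}. \<forall>S\<in>distinct_tuples k m. residual k m n w A S y \<le> r \<longrightarrow> s \<in> S ` {1..k}}"

text \<open>The preimage of each \<open>P \<subseteq> {1..m}\<close> is a finite Boolean combination
  of events that compare a residual, a polynomial in \<open>y\<close>, with
  \<open>r\<close>.\<close>

lemma support_decoder_in_recovery_maps: "support_decoder k m n w r A \<in> recovery_maps n m"
proof -
  define Q where "Q s y \<longleftrightarrow> (\<forall>S\<in>distinct_tuples k m. residual k m n w A S y \<le> r \<longrightarrow> s \<in> S ` {1..k})" for s y
  have res[measurable]: "residual k m n w A S \<in> borel_measurable (borel_vec n)" for S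
    unfolding residual_def by measurable
  have 1: "Measurable.pred (borel_vec n) (\<lambda>y. residual k m n w A S y \<le> r \<longrightarrow> c)" for S c
    by measurable
  have Q: "Measurable.pred (borel_vec n) (Q s)" for s
    unfolding Q_def by (rule pred_intros_finite(3)[OF finite_distinct_tuples 1])
  have eq: "{s \<in> I. R s} = P \<longleftrightarrow> (\<forall>s\<in>I. s \<in> P \<longleftrightarrow> R s)" if "P \<subseteq> I" for P I :: "nat set" and R
    using that by blast
  have "support_decoder k m n w r A -` {P} \<inter> space (borel_vec n) \<in> sets (borel_vec n)"
    if "P \<subseteq> {1..m}" for P
  proof -
    have "Measurable.pred (borel_vec n) (\<lambda>y. s \<in> P \<longleftrightarrow> Q s y)" for s
      using Q[of s] by (cases "s \<in> P") auto
    then have "Measurable.pred (borel_vec n) (\<lambda>y. \<forall>s\<in>{1..m}. s \<in> P \<longleftrightarrow> Q s y)"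
      by (intro pred_intros_finite(3)) auto
    moreover have "support_decoder k m n w r A -` {P} \<inter> space (borel_vec n) =
      {y \<in> space (borel_vec n). \<forall>s\<in>{1..m}. s \<in> P \<longleftrightarrow> Q s y}"
      unfolding support_decoder_def Q_def[symmetric] vimage_def Int_def singleton_iff eq[OF that] mem_Collect_eq
      by blast
    ultimately show ?thesis
      by (simp only: predE)
  qed
  moreover have "support_decoder k m n w r A y \<in> Pow {1..m}" for y
    unfolding support_decoder_def by blast
  ultimately show ?thesis
    unfolding recovery_maps_def by (subst measurable_count_space_eq2) (simp_all del: One_nat_def)
qed

section \<open>Supports and differences of signals\<close>

lemma distinct_tuples_image:
  assumes "S \<in> distinct_tuples k m"
  shows "S ` {1..k} \<subseteq> {1..m}" "card (S ` {1..k}) = k" "inj_on S {1..k}"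
  using assms by (auto simp: distinct_tuples_def card_image PiE_iff)

lemma signal_at:
  assumes "S \<in> distinct_tuples k m" "j \<in> {1..k}"
  shows "signal k w S (S j) = w j"
  using distinct_tuples_image[OF assms(1)] assms(2) by (simp add: signal_def)

lemma supp_signal:
  assumes "S \<in> distinct_tuples k m" "\<forall>i\<in>{1..k}. w i \<noteq> 0"
  shows "supp m (signal k w S) = S ` {1..k}"
proof -
  have "signal k w S s \<noteq> 0 \<longleftrightarrow> s \<in> S ` {1..k}" for s
  proof (cases "s \<in> S ` {1..k}")
    case True
    then obtain j where "j \<in> {1..k}" "s = S j" by auto
    then show ?thesis using signal_at[OF assms(1), of j w] assms(2) by auto
  qed (simp add: signal_def)
  then show ?thesis
    using distinct_tuples_image(1)[OF assms(1)] by (auto simp: supp_def)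
qed

definition signal_diff :: "nat \<Rightarrow> (nat \<Rightarrow> real) \<Rightarrow> (nat \<Rightarrow> nat) \<Rightarrow> (nat \<Rightarrow> nat) \<Rightarrow> nat \<Rightarrow> real" where
  "signal_diff k w S S' s = signal k w S s - signal k w S' s"

lemma residual_measurement:
  "residual k m n w A S' (measurement n m A (signal k w S) z) =
    (\<Sum>i=1..n. (z i + (\<Sum>s=1..m. signal_diff k w S S' s * A i s))\<^sup>2)"
  unfolding residual_def measurement_def signal_diff_def
  by (intro sum.cong) (auto simp: algebra_simps sum_subtractf)

text \<open>The coefficients of the columns in the true support that remain after subtracting a candidate;
  their number stays bounded as \<open>m\<close> grows.\<close>

definition patterns :: "nat \<Rightarrow> nat \<Rightarrow> (nat \<Rightarrow> real) \<Rightarrow> (nat \<Rightarrow> nat) \<Rightarrow> (nat \<Rightarrow> real) set" where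
  "patterns k m w S = (\<lambda>S'. restrict (signal_diff k w S S') (S ` {1..k})) ` distinct_tuples k m"

lemma finite_patterns: "finite (patterns k m w S)"
  unfolding patterns_def by (intro finite_imageI finite_distinct_tuples)

text \<open>Differences of two signals take values in the finite set \<open>?W\<close>, and a
  pattern lives on \<open>k\<close> positions. The bound depends on neither \<open>m\<close> nor
  \<open>S\<close>, so a union bound over patterns costs only a constant.\<close>

lemma card_patterns_le:
  assumes "S \<in> distinct_tuples k m"
  shows "card (patterns k m w S) \<le> card ((\<lambda>(x, y). x - y) ` (insert 0 (w ` {1..k}) \<times> insert 0 (w ` {1..k}))) ^ k"
    (is "_ \<le> card ?W ^ k")
proof -
  have s: "signal k w S' s \<in> insert 0 (w ` {1..k})" for S' s
    using inv_into_into[of s S' "{1..k}"] by (simp add: signal_def)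
  have "signal_diff k w S S' s \<in> ?W" for S' s
    unfolding signal_diff_def by (rule image_eqI[where x="(signal k w S s, signal k w S' s)"]) (use s in auto)
  then have "patterns k m w S \<subseteq> S ` {1..k} \<rightarrow>\<^sub>E ?W"
    unfolding patterns_def by (intro image_subsetI) (simp only: restrict_PiE_iff, blast)
  then have "card (patterns k m w S) \<le> card (S ` {1..k} \<rightarrow>\<^sub>E ?W)"
    by (intro card_mono finite_PiE) auto
  also have "\<dots> = card ?W ^ k"
    using distinct_tuples_image(2)[OF assms] by (simp add: card_PiE)
  finally show ?thesis .
qed

section \<open>Exponents of the three error events and the pointwise union bound\<close>

definition noise_exponent :: "real \<Rightarrow> real \<Rightarrow> (nat \<Rightarrow> real) \<Rightarrow> real \<Rightarrow> real" where
  "noise_exponent \<tau> e a z = e / 8 * (z\<^sup>2 / \<tau>\<^sup>2 - (1 + e))"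

text \<open>The variance of \<open>z + (\<Sum>s\<in>K. h s * a s)\<close> for a Gaussian row with
  deviation \<sigma> and noise with deviation \<tau>.\<close>

definition output_variance :: "real \<Rightarrow> real \<Rightarrow> nat set \<Rightarrow> (nat \<Rightarrow> real) \<Rightarrow> real" where
  "output_variance \<sigma> \<tau> K h = \<sigma>\<^sup>2 * (\<Sum>s\<in>K. (h s)\<^sup>2) + \<tau>\<^sup>2"

text \<open>For positive \<open>e\<close>, its sum over the rows is nonnegative exactly when the
  mean square of the output on \<open>K\<close> is at most \<open>1 - e\<close> times the
  variance.\<close>

definition output_exponent :: "real \<Rightarrow> real \<Rightarrow> real \<Rightarrow> nat set \<Rightarrow> (nat \<Rightarrow> real) \<Rightarrow> (nat \<Rightarrow> real) \<Rightarrow> real \<Rightarrow> real" where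
  "output_exponent \<sigma> \<tau> e K h a z =
    e / 4 * ((1 - e) - (z + (\<Sum>s\<in>K. h s * a s))\<^sup>2 / output_variance \<sigma> \<tau> K h)"

text \<open>Summed over the rows, the first term is nonnegative if the candidate passes the residual
  test, the second if the output on \<open>K\<close> is typical. The last factor of the second
  denominator is the damping that integration over \<open>J - K\<close> produces.\<close>

definition candidate_exponent ::
    "real \<Rightarrow> real \<Rightarrow> real \<Rightarrow> nat set \<Rightarrow> nat set \<Rightarrow> (nat \<Rightarrow> real) \<Rightarrow> (nat \<Rightarrow> real) \<Rightarrow> real \<Rightarrow> real" where
  "candidate_exponent \<sigma> \<tau> e J K h a z =
    ((1 + e) * \<tau>\<^sup>2 - (z + (\<Sum>s\<in>J. h s * a s))\<^sup>2) / (2 * \<tau>\<^sup>2)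
    + ((z + (\<Sum>s\<in>K. h s * a s))\<^sup>2 - (1 - e) * output_variance \<sigma> \<tau> K h)
      / (2 * \<tau>\<^sup>2 * (1 + \<sigma>\<^sup>2 / \<tau>\<^sup>2 * (\<Sum>s\<in>J - K. (h s)\<^sup>2)))"

lemma output_variance_pos: "\<tau> > 0 \<Longrightarrow> output_variance \<sigma> \<tau> K h > 0"
  unfolding output_variance_def by (intro add_nonneg_pos mult_nonneg_nonneg sum_nonneg) auto

text \<open>Each failure makes at least one of the summed exponents nonnegative, hence one
  exponential at least 1. The cases are: the true tuple fails the test; it passes but the output on
  the true support is small; neither.\<close>

lemma decoding_error_le:
  fixes \<sigma> \<tau> e :: real
  assumes w: "\<forall>i\<in>{1..k}. w i \<noteq> 0" and S: "S \<in> distinct_tuples k m" and "\<tau> > 0" "0 < e"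
    and err: "support_decoder k m n w (real n * ((1 + e) * \<tau>\<^sup>2)) A (measurement n m A (signal k w S) z)
      \<noteq> supp m (signal k w S)"
  shows "1 \<le> ennreal (exp (\<Sum>i=1..n. noise_exponent \<tau> e (A i) (z i)))
    + (\<Sum>h\<in>patterns k m w S. ennreal (exp (\<Sum>i=1..n. output_exponent \<sigma> \<tau> e (S ` {1..k}) h (A i) (z i))))
    + (\<Sum>S'\<in>{S' \<in> distinct_tuples k m. S' ` {1..k} \<noteq> S ` {1..k}}.
        ennreal (exp (\<Sum>i=1..n. candidate_exponent \<sigma> \<tau> e {1..m} (S ` {1..k}) (signal_diff k w S S') (A i) (z i))))"
    (is "1 \<le> ?G1 + (\<Sum>h\<in>?H. ?G2 h) + (\<Sum>S'\<in>?D. ?G3 S')")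
proof -
  let ?y = "measurement n m A (signal k w S) z" and ?r = "real n * ((1 + e) * \<tau>\<^sup>2)"
  have fD: "finite ?D" using finite_distinct_tuples by (rule finite_subset[rotated]) auto
  show ?thesis
  proof (cases "residual k m n w A S ?y \<le> ?r")
    case False
    then have *: "(\<Sum>i=1..n. (z i)\<^sup>2) > ?r"
      unfolding residual_measurement by (simp add: signal_diff_def)
    have "(\<Sum>i=1..n. (z i)\<^sup>2) / \<tau>\<^sup>2 \<ge> real n * (1 + e)"
      using * \<open>\<tau> > 0\<close> by (simp add: pos_le_divide_eq mult.assoc)
    then have "0 \<le> e / 8 * ((\<Sum>i=1..n. (z i)\<^sup>2) / \<tau>\<^sup>2 - real n * (1 + e))"
      using \<open>0 < e\<close> by (intro mult_nonneg_nonneg) auto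
    also have "\<dots> = (\<Sum>i=1..n. noise_exponent \<tau> e (A i) (z i))"
      unfolding noise_exponent_def
      by (simp only: sum_distrib_left[symmetric] sum_subtractf sum_divide_distrib[symmetric]) (simp add: algebra_simps)
    finally have "1 \<le> ?G1" by simp
    then show ?thesis by (simp add: add_increasing2)
  next
    case True
    \<comment> \<open>As \<open>S\<close> itself passes, the output lies inside the true support. An
      error therefore loses some true index \<open>s\<close>, which a passing candidate
      \<open>S'\<close> must omit.\<close>
    have "support_decoder k m n w ?r A ?y \<subseteq> S ` {1..k}"
      using True S unfolding support_decoder_def by auto
    with err supp_signal[OF S w] have "\<exists>s\<in>S ` {1..k}. s \<notin> support_decoder k m n w ?r A ?y"
      by auto
    then obtain s S' where s: "s \<in> S ` {1..k}" "s \<notin> S' ` {1..k}" and S': "S' \<in> distinct_tuples k m"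
      and res: "residual k m n w A S' ?y \<le> ?r"
      using distinct_tuples_image(1)[OF S] unfolding support_decoder_def by auto
    have D: "S' \<in> ?D" using s S' by auto
    let ?K = "S ` {1..k}"
    let ?h = "signal_diff k w S S'" and ?g = "restrict (signal_diff k w S S') ?K"
    let ?V = "output_variance \<sigma> \<tau> ?K ?h"
    let ?v = "\<Sum>i=1..n. (z i + (\<Sum>s\<in>?K. ?h s * A i s))\<^sup>2"
    \<comment> \<open>Only the values of \<open>?h\<close> on the true support enter the output
      part, so \<open>?h\<close> may be replaced there by its restriction, which is one of the
      patterns.\<close>
    have gV: "output_variance \<sigma> \<tau> ?K ?g = ?V" unfolding output_variance_def by simp
    have V: "?V > 0" by (rule output_variance_pos[OF \<open>\<tau> > 0\<close>])
    show ?thesis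
    proof (cases "?v < real n * ((1 - e) * ?V)")
      case True
      have g: "?g \<in> ?H" using S' by (auto simp: patterns_def)
      have "?v / ?V \<le> real n * (1 - e)"
        using True V by (simp add: pos_divide_le_eq mult.assoc)
      then have "0 \<le> e / 4 * (real n * (1 - e) - ?v / ?V)"
        using \<open>0 < e\<close> by (intro mult_nonneg_nonneg) auto
      also have "\<dots> = (\<Sum>i=1..n. output_exponent \<sigma> \<tau> e ?K ?g (A i) (z i))"
        unfolding output_exponent_def gV
        by (simp only: sum_distrib_left[symmetric] sum_subtractf sum_divide_distrib[symmetric]) (simp add: algebra_simps)
      finally have "1 \<le> ?G2 ?g" by simp
      also have "\<dots> \<le> (\<Sum>h\<in>?H. ?G2 h)"
        by (rule member_le_sum[OF g]) (simp_all add: finite_patterns)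
      finally show ?thesis by (simp add: add_increasing2 add_increasing)
    next
      case False
      define t where "t = 1 + \<sigma>\<^sup>2 / \<tau>\<^sup>2 * (\<Sum>s\<in>{1..m} - ?K. (?h s)\<^sup>2)"
      have t: "t > 0" unfolding t_def by (intro add_pos_nonneg mult_nonneg_nonneg sum_nonneg) auto
      have "(\<Sum>i=1..n. candidate_exponent \<sigma> \<tau> e {1..m} ?K ?h (A i) (z i)) =
          (?r - residual k m n w A S' ?y) / (2 * \<tau>\<^sup>2) + (?v - real n * ((1 - e) * ?V)) / (2 * \<tau>\<^sup>2 * t)"
        unfolding candidate_exponent_def residual_measurement t_def[symmetric]
        by (simp only: sum.distrib sum_subtractf sum_divide_distrib[symmetric]) (simp add: algebra_simps)
      also have "\<dots> \<ge> 0"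
        using False res t by (intro add_nonneg_nonneg divide_nonneg_nonneg) auto
      finally have "1 \<le> ?G3 S'" by simp
      also have "\<dots> \<le> (\<Sum>S'\<in>?D. ?G3 S')"
        using D fD by (intro member_le_sum) auto
      finally show ?thesis by (simp add: add_increasing2 add_increasing)
    qed
  qed
qed

section \<open>Expected error probability of a random matrix\<close>

lemma borel_measurable_gauss_vec_linear:
  assumes "finite J" "K \<subseteq> J"
  shows "(\<lambda>a. \<Sum>s\<in>K. h s * a s) \<in> borel_measurable (gauss_vec J \<sigma>)"
proof -
  have "(\<Sum>s\<in>K. h s * a s) = (\<Sum>s\<in>J. (if s \<in> K then h s else 0) * a s)" for a
    using assms by (intro sum.mono_neutral_cong_left) auto
  then show ?thesis by simp
qed

text \<open>Integrates the pointwise union bound over noise and matrix. The statement supplies a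
  majorant \<open>g\<close> of the error probability, so that measurability in the matrix has to be
  checked only for integrated sums of exponentials.\<close>

lemma expected_error_le:
  fixes \<sigma> \<tau> e :: real
  assumes w: "\<forall>i\<in>{1..k}. w i \<noteq> 0" and S: "S \<in> distinct_tuples k m"
    and \<sigma>: "\<sigma> > 0" and \<tau>: "\<tau> > 0" and e: "0 < e" "e < 1"
  shows "\<exists>g \<in> borel_measurable (gauss_matrix n m \<sigma>).
    (\<forall>A. (\<integral>\<^sup>+z. of_bool (support_decoder k m n w (real n * ((1 + e) * \<tau>\<^sup>2)) A (measurement n m A (signal k w S) z)
      \<noteq> supp m (signal k w S)) \<partial>gaussian_noise n \<tau>) \<le> g A) \<and>
    (\<integral>\<^sup>+A. g A \<partial>gauss_matrix n m \<sigma>) \<le>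
    ennreal (exp (- e\<^sup>2 / 16) ^ n + real (card (patterns k m w S)) * exp (- e\<^sup>2 / 8) ^ n
      + (\<Sum>S'\<in>{S' \<in> distinct_tuples k m. S' ` {1..k} \<noteq> S ` {1..k}}.
        exp ((e - ln (1 - e) - ln (output_variance \<sigma> \<tau> (S ` {1..k}) (signal_diff k w S S') / \<tau>\<^sup>2)) / 2) ^ n))"
proof -
  let ?M = "gauss_matrix n m \<sigma>" and ?N = "gaussian_noise n \<tau>"
  let ?H = "patterns k m w S" and ?D = "{S' \<in> distinct_tuples k m. S' ` {1..k} \<noteq> S ` {1..k}}"
  let ?K = "S ` {1..k}"
  interpret N: prob_space ?N
    unfolding gaussian_noise_def by (intro prob_space_PiM prob_space_normal_density \<tau>)
  define F where "F f = (\<lambda>(A, z). ennreal (exp (\<Sum>i=1..n. f (A i) (z i))))" for f :: "(nat \<Rightarrow> real) \<Rightarrow> real \<Rightarrow> real"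
  let ?f2 = "output_exponent \<sigma> \<tau> e ?K"
  let ?f3 = "\<lambda>S'. candidate_exponent \<sigma> \<tau> e {1..m} ?K (signal_diff k w S S')"
  have KJ: "?K \<subseteq> {1..m}" by (rule distinct_tuples_image(1)[OF S])
  have [measurable]: "(\<lambda>a. \<Sum>s\<in>?K. h s * a s) \<in> borel_measurable (gauss_vec {1..m} \<sigma>)" for h
    by (rule borel_measurable_gauss_vec_linear[OF _ KJ]) simp
  have m1: "case_prod (noise_exponent \<tau> e) \<in> borel_measurable (gauss_vec {1..m} \<sigma> \<Otimes>\<^sub>M gauss \<tau>)"
    unfolding noise_exponent_def by measurable
  have m2: "case_prod (?f2 h) \<in> borel_measurable (gauss_vec {1..m} \<sigma> \<Otimes>\<^sub>M gauss \<tau>)" for h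
    unfolding output_exponent_def by measurable
  have m3: "case_prod (?f3 S') \<in> borel_measurable (gauss_vec {1..m} \<sigma> \<Otimes>\<^sub>M gauss \<tau>)" for S'
    unfolding candidate_exponent_def by measurable
  have F_meas: "F f \<in> borel_measurable (?M \<Otimes>\<^sub>M ?N)"
    if "case_prod f \<in> borel_measurable (gauss_vec {1..m} \<sigma> \<Otimes>\<^sub>M gauss \<tau>)" for f
    unfolding F_def by (rule measurable_gauss_rows[OF that])
  note M1 = F_meas[OF m1] and M2 = F_meas[OF m2] and M3 = F_meas[OF m3]
  have F_le: "(\<integral>\<^sup>+p. F f p \<partial>(?M \<Otimes>\<^sub>M ?N)) \<le> ennreal (c ^ n)"
    if "c \<ge> 0" "case_prod f \<in> borel_measurable (gauss_vec {1..m} \<sigma> \<Otimes>\<^sub>M gauss \<tau>)"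
      "(\<integral>\<^sup>+a. (\<integral>\<^sup>+z. ennreal (exp (f a z)) \<partial>gauss \<tau>) \<partial>gauss_vec {1..m} \<sigma>) \<le> ennreal c" for f c
    using nn_integral_gauss_rows[OF \<sigma> \<tau> that(1) that(2) that(3), of n] N.nn_integral_fst[OF F_meas[OF that(2)]]
    by (simp add: F_def)
  define g where "g A = (\<integral>\<^sup>+z. F (noise_exponent \<tau> e) (A, z) + (\<Sum>h\<in>?H. F (?f2 h) (A, z))
      + (\<Sum>S'\<in>?D. F (?f3 S') (A, z)) \<partial>?N)" for A
  have err: "(\<integral>\<^sup>+z. of_bool (support_decoder k m n w (real n * ((1 + e) * \<tau>\<^sup>2)) A (measurement n m A (signal k w S) z)
      \<noteq> supp m (signal k w S)) \<partial>?N) \<le> g A" for A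
    unfolding g_def using decoding_error_le[OF w S \<tau> e(1)]
    by (intro nn_integral_mono) (simp add: F_def of_bool_def)
  have g_meas: "g \<in> borel_measurable ?M"
    unfolding g_def
    by (rule N.borel_measurable_nn_integral_fst) (intro borel_measurable_add borel_measurable_sum M1 M2 M3)
  have "(\<integral>\<^sup>+A. g A \<partial>?M) = (\<integral>\<^sup>+p. F (noise_exponent \<tau> e) p + (\<Sum>h\<in>?H. F (?f2 h) p) + (\<Sum>S'\<in>?D. F (?f3 S') p) \<partial>(?M \<Otimes>\<^sub>M ?N))"
    unfolding g_def
    by (rule N.nn_integral_fst) (intro borel_measurable_add borel_measurable_sum M1 M2 M3)
  also have "\<dots> = (\<integral>\<^sup>+p. F (noise_exponent \<tau> e) p \<partial>(?M \<Otimes>\<^sub>M ?N)) + (\<Sum>h\<in>?H. \<integral>\<^sup>+p. F (?f2 h) p \<partial>(?M \<Otimes>\<^sub>M ?N))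
      + (\<Sum>S'\<in>?D. \<integral>\<^sup>+p. F (?f3 S') p \<partial>(?M \<Otimes>\<^sub>M ?N))"
    using M1 M2 M3 by (simp add: nn_integral_add nn_integral_sum del: One_nat_def)
  also have "\<dots> \<le> ennreal (exp (- e\<^sup>2 / 16) ^ n) + (\<Sum>h\<in>?H. ennreal (exp (- e\<^sup>2 / 8) ^ n))
      + (\<Sum>S'\<in>?D. ennreal (exp ((e - ln (1 - e) - ln (output_variance \<sigma> \<tau> ?K (signal_diff k w S S') / \<tau>\<^sup>2)) / 2) ^ n))"
  proof (intro add_mono sum_mono F_le m1 m2 m3)
    show "(\<integral>\<^sup>+a. (\<integral>\<^sup>+z. ennreal (exp (noise_exponent \<tau> e a z)) \<partial>gauss \<tau>) \<partial>gauss_vec {1..m} \<sigma>) \<le> ennreal (exp (- e\<^sup>2 / 16))"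
      unfolding noise_exponent_def using \<sigma> \<tau> e by (intro chernoff_noise_large) auto
    show "(\<integral>\<^sup>+a. (\<integral>\<^sup>+z. ennreal (exp (?f2 h a z)) \<partial>gauss \<tau>) \<partial>gauss_vec {1..m} \<sigma>) \<le> ennreal (exp (- e\<^sup>2 / 8))" for h
      unfolding output_exponent_def output_variance_def using \<sigma> \<tau> e KJ by (intro chernoff_output_small) auto
    show "(\<integral>\<^sup>+a. (\<integral>\<^sup>+z. ennreal (exp (?f3 S' a z)) \<partial>gauss \<tau>) \<partial>gauss_vec {1..m} \<sigma>) \<le>
      ennreal (exp ((e - ln (1 - e) - ln (output_variance \<sigma> \<tau> ?K (signal_diff k w S S') / \<tau>\<^sup>2)) / 2))" for S'
      unfolding candidate_exponent_def output_variance_def using \<sigma> \<tau> e KJ by (intro chernoff_wrong_candidate) auto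
  qed auto
  also have "\<dots> = ennreal (exp (- e\<^sup>2 / 16) ^ n + real (card ?H) * exp (- e\<^sup>2 / 8) ^ n
      + (\<Sum>S'\<in>?D. exp ((e - ln (1 - e) - ln (output_variance \<sigma> \<tau> ?K (signal_diff k w S S') / \<tau>\<^sup>2)) / 2) ^ n))"
    by (simp add: sum_ennreal ennreal_plus sum_nonneg ennreal_mult ennreal_of_nat_eq_real_of_nat del: ennreal_plus[symmetric])
  finally show ?thesis
    using g_meas err by blast
qed

section \<open>Counting wrong candidates\<close>

definition missed :: "nat \<Rightarrow> (nat \<Rightarrow> nat) \<Rightarrow> (nat \<Rightarrow> nat) \<Rightarrow> nat set" where
  "missed k S S' = {j \<in> {1..k}. S' j \<notin> S ` {1..k}}"

lemma card_missed:
  assumes "S \<in> distinct_tuples k m" "S' \<in> distinct_tuples k m"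
  shows "card (missed k S S') = card (S' ` {1..k} - S ` {1..k})"
proof -
  have "S' ` missed k S S' = S' ` {1..k} - S ` {1..k}"
    by (auto simp: missed_def)
  moreover have "inj_on S' (missed k S S')"
    using distinct_tuples_image(3)[OF assms(2)] by (rule inj_on_subset) (auto simp: missed_def)
  ultimately show ?thesis by (metis card_image)
qed

text \<open>Both supports have \<open>k\<close> elements, so their two differences have equal size.
  This links the number of candidates, governed by the wrong positions \<open>missed k S S'\<close>,
  to their exponent, governed by the missed true positions \<open>missed k S' S\<close>.\<close>

lemma card_missed_commute:
  assumes "S \<in> distinct_tuples k m" "S' \<in> distinct_tuples k m"
  shows "card (missed k S S') = card (missed k S' S)"
proof -
  have "card (S' ` {1..k} - S ` {1..k}) = card (S ` {1..k} - S' ` {1..k})"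
    using distinct_tuples_image(2)[OF assms(1)] distinct_tuples_image(2)[OF assms(2)]
    by (simp add: card_Diff_subset_Int Int_commute)
  then show ?thesis using card_missed assms by simp
qed

lemma missed_nonempty:
  assumes "S \<in> distinct_tuples k m" "S' \<in> distinct_tuples k m" "S' ` {1..k} \<noteq> S ` {1..k}"
  shows "missed k S S' \<noteq> {}"
proof
  assume "missed k S S' = {}"
  then have "S' ` {1..k} \<subseteq> S ` {1..k}" by (auto simp: missed_def)
  then have "S' ` {1..k} = S ` {1..k}"
    using distinct_tuples_image(2)[OF assms(1)] distinct_tuples_image(2)[OF assms(2)]
    by (intro card_subset_eq) auto
  with assms(3) show False by simp
qed

text \<open>A position in \<open>T\<close> has at most \<open>m\<close> possible values, any other
  position only the \<open>k\<close> elements of the true support.\<close>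

lemma card_tuples_missed_le:
  assumes "S \<in> distinct_tuples k m" "T \<subseteq> {1..k}"
  shows "card {S' \<in> distinct_tuples k m. missed k S S' = T} \<le> k ^ k * m ^ card T"
proof -
  let ?B = "\<lambda>j. if j \<in> T then {1..m} else S ` {1..k}"
  have "{S' \<in> distinct_tuples k m. missed k S S' = T} \<subseteq> PiE {1..k} ?B"
    unfolding missed_def distinct_tuples_def by (auto intro!: PiE_I dest: PiE_mem PiE_arb)
  then have "card {S' \<in> distinct_tuples k m. missed k S S' = T} \<le> card (PiE {1..k} ?B)"
    by (intro card_mono finite_PiE) auto
  also have "\<dots> = (\<Prod>j\<in>{1..k}. if j \<in> T then m else k)"
    using distinct_tuples_image(2)[OF assms(1)] by (subst card_PiE) (auto intro!: prod.cong)
  also have "\<dots> = m ^ card T * k ^ card ({1..k} - T)"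
    using assms(2) by (subst prod.subset_diff[OF assms(2)]) (simp_all add: mult.commute)
  also have "\<dots> \<le> m ^ card T * k ^ k"
  \<comment> \<open>Monotonicity of the power of \<open>k\<close> in its exponent requires base at
    least 1.\<close>
  proof (cases "k = 0")
    case False
    have "card ({1..k} - T) \<le> k" using card_mono[of "{1..k}" "{1..k} - T"] by auto
    then show ?thesis using False by (intro mult_left_mono power_increasing) auto
  qed auto
  finally show ?thesis by (simp add: mult.commute)
qed

text \<open>Candidates are grouped by the set \<open>T\<close> of their wrong positions: at most
  \<open>2 ^ k\<close> groups, each with at most \<open>k ^ k * m ^ card T\<close> members, and
  \<open>B\<close> bounds what the power of \<open>m\<close> leaves of \<open>q\<close>.\<close>

lemma sum_wrong_candidates_le:
  fixes g :: "(nat \<Rightarrow> nat) \<Rightarrow> real" and q :: "nat \<Rightarrow> real"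
  assumes S: "S \<in> distinct_tuples k m"
    and g: "\<And>S'. S' \<in> distinct_tuples k m \<Longrightarrow> S' ` {1..k} \<noteq> S ` {1..k} \<Longrightarrow> g S' \<le> q (card (missed k S S'))"
    and q: "\<And>t. q t \<ge> 0" "\<And>t. 1 \<le> t \<Longrightarrow> t \<le> k \<Longrightarrow> real m ^ t * q t \<le> B"
    and B: "B \<ge> 0"
  shows "(\<Sum>S'\<in>{S' \<in> distinct_tuples k m. S' ` {1..k} \<noteq> S ` {1..k}}. g S') \<le> real (2 ^ k * k ^ k) * B"
proof -
  let ?D = "{S' \<in> distinct_tuples k m. S' ` {1..k} \<noteq> S ` {1..k}}" and ?P = "Pow {1..k} - {{}}"
  have fD: "finite ?D" using finite_distinct_tuples by (rule finite_subset[rotated]) auto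
  have "(\<Sum>S'\<in>?D. g S') = (\<Sum>T\<in>?P. \<Sum>S'\<in>{S' \<in> ?D. missed k S S' = T}. g S')"
  proof (rule sum.group[symmetric, OF fD])
    have "missed k S S' \<in> ?P" if "S' \<in> ?D" for S'
      using missed_nonempty[OF S, of S'] that unfolding missed_def by blast
    then show "missed k S ` ?D \<subseteq> ?P" by blast
  qed simp
  also have "\<dots> \<le> (\<Sum>T\<in>?P. real (k ^ k) * B)"
  proof (rule sum_mono)
    fix T assume T: "T \<in> ?P"
    have fT: "finite T" using T finite_subset by auto
    have t: "1 \<le> card T" "card T \<le> k"
      using T fT card_mono[of "{1..k}" T] by (auto simp: Suc_le_eq card_gt_0_iff)
    have "(\<Sum>S'\<in>{S' \<in> ?D. missed k S S' = T}. g S') \<le> (\<Sum>S'\<in>{S' \<in> ?D. missed k S S' = T}. q (card T))"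
    proof (rule sum_mono)
      fix S' assume "S' \<in> {S' \<in> ?D. missed k S S' = T}"
      then have "S' \<in> distinct_tuples k m" "S' ` {1..k} \<noteq> S ` {1..k}" "missed k S S' = T"
        by blast+
      then show "g S' \<le> q (card T)" using g[of S'] by simp
    qed
    also have "\<dots> = real (card {S' \<in> ?D. missed k S S' = T}) * q (card T)" by simp
    also have "\<dots> \<le> real (k ^ k * m ^ card T) * q (card T)"
    proof (intro mult_right_mono q(1))
      have "card {S' \<in> ?D. missed k S S' = T} \<le> card {S' \<in> distinct_tuples k m. missed k S S' = T}"
        using finite_distinct_tuples[of k m] by (intro card_mono) auto
      also have "\<dots> \<le> k ^ k * m ^ card T"
        using T by (intro card_tuples_missed_le[OF S]) auto
      finally show "real (card {S' \<in> ?D. missed k S S' = T}) \<le> real (k ^ k * m ^ card T)"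
        by (rule of_nat_mono)
    qed
    also have "\<dots> = real (k ^ k) * (real m ^ card T * q (card T))" by simp
    also have "\<dots> \<le> real (k ^ k) * B"
      using q(2)[OF t] by (intro mult_left_mono) auto
    finally show "(\<Sum>S'\<in>{S' \<in> ?D. missed k S S' = T}. g S') \<le> real (k ^ k) * B" .
  qed
  also have "\<dots> = real (card ?P) * (real (k ^ k) * B)" by simp
  also have "\<dots> \<le> real (2 ^ k) * (real (k ^ k) * B)"
    using B by (intro mult_right_mono of_nat_mono) (auto simp: card_Diff_singleton card_Pow)
  finally show ?thesis by (simp add: mult.assoc)
qed

section \<open>A good matrix\<close>

text \<open>Conditioning on the tuple: by independence the joint law is integrated first over the
  noise, then over the finite uniform law of \<open>S\<close>.\<close>

lemma avg_error_prob_eq: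
  assumes "k \<le> m" "\<tau> > 0" "d \<in> recovery_maps n m"
  shows "ennreal (avg_error_prob k m n \<tau> w A d) =
    (\<Sum>S\<in>distinct_tuples k m. ennreal (1 / real (card (distinct_tuples k m))) *
      (\<integral>\<^sup>+z. of_bool (d (measurement n m A (signal k w S) z) \<noteq> supp m (signal k w S)) \<partial>gaussian_noise n \<tau>))"
proof -
  interpret M: prob_space "model k m n \<tau>" by (rule prob_space_model[OF assms(1,2)])
  interpret N: prob_space "gaussian_noise n \<tau>"
    unfolding gaussian_noise_def by (intro prob_space_PiM prob_space_normal_density assms)
  let ?P = "\<lambda>S z. d (measurement n m A (signal k w S) z) \<noteq> supp m (signal k w S)"
  let ?E = "{x \<in> space (model k m n \<tau>). case x of (S, z) \<Rightarrow> ?P S z}"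
  let ?U = "uniform_count_measure (distinct_tuples k m)"
  have E: "?E \<in> sets (model k m n \<tau>)"
    using error_event_measurable[OF assms(3), of k \<tau> A w] by (simp add: case_prod_unfold)
  have "ennreal (avg_error_prob k m n \<tau> w A d) = emeasure (model k m n \<tau>) ?E"
    unfolding avg_error_prob_def by (auto simp: M.emeasure_eq_measure intro!: arg_cong[where f=M.prob])
  also have "\<dots> = (\<integral>\<^sup>+x. indicator ?E x \<partial>model k m n \<tau>)"
    using E by simp
  also have "\<dots> = (\<integral>\<^sup>+S. (\<integral>\<^sup>+z. indicator ?E (S, z) \<partial>gaussian_noise n \<tau>) \<partial>?U)"
    using E unfolding model_def by (intro N.nn_integral_fst[symmetric]) auto
  also have "\<dots> = (\<integral>\<^sup>+S. (\<integral>\<^sup>+z. of_bool (?P S z) \<partial>gaussian_noise n \<tau>) \<partial>?U)"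
    by (intro nn_integral_cong) (auto simp: indicator_def model_def space_pair_measure)
  also have "\<dots> = (\<Sum>S\<in>distinct_tuples k m. ennreal (1 / real (card (distinct_tuples k m))) *
      (\<integral>\<^sup>+z. of_bool (?P S z) \<partial>gaussian_noise n \<tau>))"
    unfolding uniform_count_measure_def by (rule nn_integral_point_measure_finite[OF finite_distinct_tuples])
  finally show ?thesis .
qed

text \<open>First-moment method with two constraints: a combination \<open>F\<close> of scaled error
  and scaled power has expectation below 1, so some matrix has \<open>F A \<le> 1\<close>, and then
  each of the two nonnegative summands is at most 1.\<close>

lemma exists_good_matrix:
  fixes \<sigma> \<tau> e B :: real
  assumes w: "\<forall>i\<in>{1..k}. w i \<noteq> 0" and km: "k \<le> m" and m: "m > 0" and n: "n > 0"
    and \<sigma>: "0 < \<sigma>" "\<sigma> < \<sigma>\<^sub>a" and \<tau>: "\<tau> > 0" and e: "0 < e" "e < 1" and B: "B > 0"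
    and le: "\<And>S. S \<in> distinct_tuples k m \<Longrightarrow>
      exp (- e\<^sup>2 / 16) ^ n + real (card (patterns k m w S)) * exp (- e\<^sup>2 / 8) ^ n
      + (\<Sum>S'\<in>{S' \<in> distinct_tuples k m. S' ` {1..k} \<noteq> S ` {1..k}}.
        exp ((e - ln (1 - e) - ln (output_variance \<sigma> \<tau> (S ` {1..k}) (signal_diff k w S S') / \<tau>\<^sup>2)) / 2) ^ n) \<le> B"
  shows "\<exists>A. 1 / (real n * real m) * (frob_norm n m A)\<^sup>2 \<le> \<sigma>\<^sub>a\<^sup>2 \<and>
    avg_error_prob k m n \<tau> w A (support_decoder k m n w (real n * ((1 + e) * \<tau>\<^sup>2)) A) \<le> 2 * B / (1 - \<sigma>\<^sup>2 / \<sigma>\<^sub>a\<^sup>2)"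
proof -
  let ?M = "gauss_matrix n m \<sigma>" and ?D = "distinct_tuples k m"
  let ?d = "support_decoder k m n w (real n * ((1 + e) * \<tau>\<^sup>2))"
  define err where "err S A = (\<integral>\<^sup>+z. of_bool (?d A (measurement n m A (signal k w S) z)
      \<noteq> supp m (signal k w S)) \<partial>gaussian_noise n \<tau>)" for S A
  interpret M: prob_space ?M by (rule prob_space_gauss_matrix[OF \<sigma>(1)])
  have "\<forall>S\<in>?D. \<exists>g \<in> borel_measurable ?M. (\<forall>A. err S A \<le> g A) \<and> (\<integral>\<^sup>+A. g A \<partial>?M) \<le> ennreal B"
  proof
    fix S assume S: "S \<in> ?D"
    from expected_error_le[OF w S \<sigma>(1) \<tau> e, of n] ennreal_leI[OF le[OF S]]
    show "\<exists>g \<in> borel_measurable ?M. (\<forall>A. err S A \<le> g A) \<and> (\<integral>\<^sup>+A. g A \<partial>?M) \<le> ennreal B"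
      unfolding err_def by (meson order_trans)
  qed
  then obtain g where g: "\<And>S. S \<in> ?D \<Longrightarrow> g S \<in> borel_measurable ?M"
      "\<And>S A. S \<in> ?D \<Longrightarrow> err S A \<le> g S A" "\<And>S. S \<in> ?D \<Longrightarrow> (\<integral>\<^sup>+A. g S A \<partial>?M) \<le> ennreal B"
    by (metis (no_types, lifting) bchoice)
  define N where "N = real (card ?D)"
  have N: "N > 0" unfolding N_def using distinct_tuples_nonempty[OF km] finite_distinct_tuples by (simp add: card_gt_0_iff)
  \<comment> \<open>The average over \<open>S\<close> of the majorants is a measurable upper bound
    of the average error probability.\<close>
  define U where "U A = (\<Sum>S\<in>?D. ennreal (1 / N) * g S A)" for A
  have U_meas: "U \<in> borel_measurable ?M"
    unfolding U_def using g(1) by (intro borel_measurable_sum borel_measurable_times) auto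
  have U_le: "(\<integral>\<^sup>+A. U A \<partial>?M) \<le> ennreal B"
  proof -
    have "(\<integral>\<^sup>+A. U A \<partial>?M) = (\<Sum>S\<in>?D. ennreal (1 / N) * (\<integral>\<^sup>+A. g S A \<partial>?M))"
      unfolding U_def using g(1) by (simp add: nn_integral_sum nn_integral_cmult)
    also have "\<dots> \<le> (\<Sum>S\<in>?D. ennreal (1 / N) * ennreal B)"
      using g(3) by (intro sum_mono mult_left_mono) auto
    also have "\<dots> = ennreal N * (ennreal (1 / N) * ennreal B)"
      by (simp add: N_def ennreal_of_nat_eq_real_of_nat)
    also have "\<dots> = ennreal B"
      using N B by (simp add: ennreal_mult[symmetric])
    finally show ?thesis .
  qed
  have avg_le: "ennreal (avg_error_prob k m n \<tau> w A (?d A)) \<le> U A" for A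
    unfolding avg_error_prob_eq[OF km \<tau> support_decoder_in_recovery_maps] U_def N_def
    using g(2) unfolding err_def by (intro sum_mono mult_left_mono) auto
  define \<rho> where "\<rho> = \<sigma>\<^sup>2 / \<sigma>\<^sub>a\<^sup>2"
  have \<rho>: "0 < \<rho>" "\<rho> < 1"
    using \<sigma> by (auto simp: \<rho>_def power_strict_mono)
  \<comment> \<open>With this threshold the error term contributes at most
    \<open>(1 - \<rho>) / 2\<close> and the power term \<rho>, in total
    \<open>(1 + \<rho>) / 2 < 1\<close>.\<close>
  define \<delta> where "\<delta> = 2 * B / (1 - \<rho>)"
  have \<delta>: "\<delta> > 0" using \<rho> B by (simp add: \<delta>_def)
  define c where "c = 1 / (real n * real m * \<sigma>\<^sub>a\<^sup>2)"
  have c: "c > 0" using n m \<sigma> by (simp add: c_def)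
  define F where "F A = ennreal (1 / \<delta>) * U A + ennreal c * ennreal ((frob_norm n m A)\<^sup>2)" for A
  have "(\<integral>\<^sup>+A. F A \<partial>?M) = ennreal (1 / \<delta>) * (\<integral>\<^sup>+A. U A \<partial>?M) + ennreal c * ennreal (real n * real m * \<sigma>\<^sup>2)"
    unfolding F_def nn_integral_gauss_matrix_frob_norm[OF \<sigma>(1), symmetric]
    using U_meas measurable_gauss_matrix_frob_norm[of n m \<sigma>]
    by (simp add: nn_integral_add nn_integral_cmult del: One_nat_def)
  also have "\<dots> \<le> ennreal (1 / \<delta>) * ennreal B + ennreal c * ennreal (real n * real m * \<sigma>\<^sup>2)"
    using U_le by (intro add_mono mult_left_mono) auto
  also have "\<dots> = ennreal (1 / \<delta> * B + c * (real n * real m * \<sigma>\<^sup>2))"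
    using \<delta> B c by (simp add: ennreal_mult[symmetric] ennreal_plus[symmetric] del: ennreal_plus)
  also have "1 / \<delta> * B + c * (real n * real m * \<sigma>\<^sup>2) = (1 - \<rho>) / 2 + \<rho>"
    using n m \<sigma> B \<rho> by (simp add: \<delta>_def c_def \<rho>_def)
  also have "ennreal ((1 - \<rho>) / 2 + \<rho>) < 1"
    using \<rho> by (simp only: ennreal_less_one_iff) (simp add: field_simps)
  finally have F_less: "(\<integral>\<^sup>+A. F A \<partial>?M) < 1" .
  have "\<exists>A. F A \<le> 1"
  proof (rule ccontr)
    assume "\<not> (\<exists>A. F A \<le> 1)"
    then have "(\<integral>\<^sup>+A. 1 \<partial>?M) \<le> (\<integral>\<^sup>+A. F A \<partial>?M)"
      by (intro nn_integral_mono) (auto simp: not_le intro: less_imp_le)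
    with F_less show False by (simp add: M.emeasure_space_1 del: One_nat_def)
  qed
  then obtain A where A: "F A \<le> 1" ..
  have "ennreal (c * (frob_norm n m A)\<^sup>2) \<le> 1"
    using A c unfolding F_def by (simp add: ennreal_mult) (metis add_increasing le_iff_add order_trans add.commute)
  then have "c * (frob_norm n m A)\<^sup>2 \<le> 1"
    by simp
  then have 1: "1 / (real n * real m) * (frob_norm n m A)\<^sup>2 \<le> \<sigma>\<^sub>a\<^sup>2"
    using n m \<sigma> by (simp add: c_def field_simps)
  have "ennreal (1 / \<delta> * avg_error_prob k m n \<tau> w A (?d A)) = ennreal (1 / \<delta>) * ennreal (avg_error_prob k m n \<tau> w A (?d A))"
    using \<delta> by (intro ennreal_mult) (auto simp: avg_error_prob_def)
  also have "\<dots> \<le> ennreal (1 / \<delta>) * U A"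
    by (intro mult_left_mono avg_le) auto
  also have "\<dots> \<le> 1"
    using A unfolding F_def by (metis le_iff_add order_trans)
  finally have "avg_error_prob k m n \<tau> w A (?d A) \<le> \<delta>"
    using \<delta> by (simp add: field_simps)
  with 1 show ?thesis
    unfolding \<delta>_def \<rho>_def by blast
qed

section \<open>Exponential decay of the error below capacity\<close>

lemma output_variance_ge:
  assumes S: "S \<in> distinct_tuples k m" and \<tau>: "\<tau> > 0"
  shows "1 + \<sigma>\<^sup>2 / \<tau>\<^sup>2 * (\<Sum>j\<in>missed k S' S. (w j)\<^sup>2) \<le> output_variance \<sigma> \<tau> (S ` {1..k}) (signal_diff k w S S') / \<tau>\<^sup>2"
proof -
  have "(\<Sum>j\<in>missed k S' S. (w j)\<^sup>2) = (\<Sum>s\<in>S ` missed k S' S. (signal_diff k w S S' s)\<^sup>2)"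
  proof (subst sum.reindex)
    show "inj_on S (missed k S' S)"
      using distinct_tuples_image(3)[OF S] by (rule inj_on_subset) (auto simp: missed_def)
    \<comment> \<open>At a true position omitted by the candidate, the candidate signal is zero and
      nothing is subtracted from \<open>w j\<close>. All other squares are dropped
      afterwards.\<close>
    have "signal_diff k w S S' (S j) = w j" if "j \<in> missed k S' S" for j
      using that signal_at[OF S, of j w] by (simp add: missed_def signal_diff_def signal_def)
    then show "(\<Sum>j\<in>missed k S' S. (w j)\<^sup>2) = sum ((\<lambda>s. (signal_diff k w S S' s)\<^sup>2) \<circ> S) (missed k S' S)"
      by simp
  qed
  also have "\<dots> \<le> (\<Sum>s\<in>S ` {1..k}. (signal_diff k w S S' s)\<^sup>2)"
    by (intro sum_mono2 image_mono) (auto simp: missed_def)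
  finally have "\<sigma>\<^sup>2 / \<tau>\<^sup>2 * (\<Sum>j\<in>missed k S' S. (w j)\<^sup>2) \<le> \<sigma>\<^sup>2 / \<tau>\<^sup>2 * (\<Sum>s\<in>S ` {1..k}. (signal_diff k w S S' s)\<^sup>2)"
    by (intro mult_left_mono) auto
  then show ?thesis
    using \<tau> by (simp add: output_variance_def add_divide_distrib)
qed

text \<open>The three summands of \<open>C\<close> account for noise, patterns and wrong candidates.
  For the last, \<open>\<gamma>\<close> bounds the rate and \<open>\<gamma>'\<close> the capacity
  from below, in natural logarithms; the gap pays both for the error terms in \<open>e\<close> and
  for the decay \<open>\<kappa>\<close>.\<close>

lemma random_coding_bound_le:
  fixes \<sigma> \<tau> e \<gamma> \<gamma>' :: real
  assumes S: "S \<in> distinct_tuples k m" and m: "m > 0" and \<tau>: "\<tau> > 0"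
    and e: "0 < e" "e \<le> 1 / 2" "3 * e \<le> \<gamma>' - \<gamma>"
    and rate: "ln (real m) \<le> real n * \<gamma>"
    and cap: "\<And>T. T \<noteq> {} \<Longrightarrow> T \<subseteq> {1..k} \<Longrightarrow> \<gamma>' * real (card T) \<le> 1 / 2 * ln (1 + \<sigma>\<^sup>2 / \<tau>\<^sup>2 * (\<Sum>j\<in>T. (w j)\<^sup>2))"
  defines "C \<equiv> 1 + real (card ((\<lambda>(x, y). x - y) ` (insert 0 (w ` {1..k}) \<times> insert 0 (w ` {1..k}))) ^ k)
      + real (2 ^ k * k ^ k)"
    and "\<kappa> \<equiv> min (e\<^sup>2 / 16) ((\<gamma>' - \<gamma>) / 2)"
  shows "exp (- e\<^sup>2 / 16) ^ n + real (card (patterns k m w S)) * exp (- e\<^sup>2 / 8) ^ n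
      + (\<Sum>S'\<in>{S' \<in> distinct_tuples k m. S' ` {1..k} \<noteq> S ` {1..k}}.
        exp ((e - ln (1 - e) - ln (output_variance \<sigma> \<tau> (S ` {1..k}) (signal_diff k w S S') / \<tau>\<^sup>2)) / 2) ^ n)
    \<le> C * exp (- \<kappa> * real n)"
proof -
  have pow: "exp x ^ n \<le> exp (- \<kappa> * real n)" if "x \<le> - \<kappa>" for x
    using mult_left_mono[OF that, of "real n"] by (simp add: exp_of_nat_mult[symmetric] mult.commute)
  \<comment> \<open>Turns \<open>- ln (1 - e) \<le> e + 2 * e\<^sup>2\<close> into
    \<open>e - ln (1 - e) \<le> 3 * e\<close> below.\<close>
  have e2: "2 * e\<^sup>2 \<le> e"
    using mult_left_mono[OF e(2), of e] e(1) by (simp add: power2_eq_square)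
  have \<kappa>1: "- e\<^sup>2 / 16 \<le> - \<kappa>" and \<kappa>2: "- e\<^sup>2 / 8 \<le> - \<kappa>" and \<kappa>3: "- (\<gamma>' - \<gamma>) / 2 \<le> - \<kappa>"
  proof -
    have "\<kappa> \<le> e\<^sup>2 / 16" "\<kappa> \<le> (\<gamma>' - \<gamma>) / 2" unfolding \<kappa>_def by (rule min.cobounded1, rule min.cobounded2)
    then show "- e\<^sup>2 / 16 \<le> - \<kappa>" "- e\<^sup>2 / 8 \<le> - \<kappa>" "- (\<gamma>' - \<gamma>) / 2 \<le> - \<kappa>"
      using zero_le_power2[of e] by linarith+
  qed
  have t1: "exp (- e\<^sup>2 / 16) ^ n \<le> 1 * exp (- \<kappa> * real n)"
    using pow[OF \<kappa>1] by simp
  have t2: "real (card (patterns k m w S)) * exp (- e\<^sup>2 / 8) ^ n \<le>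
      real (card ((\<lambda>(x, y). x - y) ` (insert 0 (w ` {1..k}) \<times> insert 0 (w ` {1..k}))) ^ k) * exp (- \<kappa> * real n)"
    using pow[OF \<kappa>2] card_patterns_le[OF S, of w] by (intro mult_mono of_nat_mono) auto
  have ln1: "e - ln (1 - e) \<le> 3 * e"
    using ln_one_minus_pos_lower_bound[of e] e e2 by simp
  have t3: "(\<Sum>S'\<in>{S' \<in> distinct_tuples k m. S' ` {1..k} \<noteq> S ` {1..k}}.
        exp ((e - ln (1 - e) - ln (output_variance \<sigma> \<tau> (S ` {1..k}) (signal_diff k w S S') / \<tau>\<^sup>2)) / 2) ^ n)
      \<le> real (2 ^ k * k ^ k) * exp (- \<kappa> * real n)"
  proof (rule sum_wrong_candidates_le[OF S, where q="\<lambda>t. exp (real n * (3 * e / 2 - \<gamma>' * real t))"])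
    fix S' assume S': "S' \<in> distinct_tuples k m" "S' ` {1..k} \<noteq> S ` {1..k}"
    let ?V = "output_variance \<sigma> \<tau> (S ` {1..k}) (signal_diff k w S S')" and ?T = "missed k S' S"
    have T: "?T \<noteq> {}" "?T \<subseteq> {1..k}"
      using missed_nonempty[OF S'(1) S] S'(2) by (auto simp: missed_def)
    have "\<gamma>' * real (card ?T) \<le> 1 / 2 * ln (1 + \<sigma>\<^sup>2 / \<tau>\<^sup>2 * (\<Sum>j\<in>?T. (w j)\<^sup>2))"
      by (rule cap[OF T])
    also have "\<dots> \<le> 1 / 2 * ln (?V / \<tau>\<^sup>2)"
      using output_variance_ge[OF S \<tau>, where \<sigma>=\<sigma> and S'=S' and w=w]
        add_pos_nonneg[OF zero_less_one mult_nonneg_nonneg[of "\<sigma>\<^sup>2 / \<tau>\<^sup>2" "\<Sum>j\<in>?T. (w j)\<^sup>2"]]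
      by (intro mult_left_mono ln_mono) (simp_all add: sum_nonneg)
    \<comment> \<open>The capacity bound concerns the true positions missed by \<open>S'\<close>,
      the count its wrong positions; the two numbers agree.\<close>
    finally have "(e - ln (1 - e) - ln (?V / \<tau>\<^sup>2)) / 2 \<le> 3 * e / 2 - \<gamma>' * real (card (missed k S S'))"
      using ln1 card_missed_commute[OF S S'(1)] by simp
    then have "real n * ((e - ln (1 - e) - ln (?V / \<tau>\<^sup>2)) / 2) \<le> real n * (3 * e / 2 - \<gamma>' * real (card (missed k S S')))"
      by (rule mult_left_mono) simp
    then show "exp ((e - ln (1 - e) - ln (?V / \<tau>\<^sup>2)) / 2) ^ n \<le> exp (real n * (3 * e / 2 - \<gamma>' * real (card (missed k S S'))))"
      unfolding exp_of_nat_mult[symmetric] by simp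
  next
    fix t :: nat assume t: "1 \<le> t" "t \<le> k"
    have "real m ^ t * exp (real n * (3 * e / 2 - \<gamma>' * real t)) =
        exp (real t * ln (real m) + real n * (3 * e / 2 - \<gamma>' * real t))"
      using m by (simp add: exp_add exp_of_nat_mult)
    also have "\<dots> \<le> exp (- \<kappa> * real n)"
    proof -
      have "real t * ln (real m) \<le> real t * (real n * \<gamma>)"
        by (intro mult_left_mono rate) auto
      then have 1: "real t * ln (real m) + real n * (3 * e / 2 - \<gamma>' * real t) \<le> real n * (3 * e / 2 - real t * (\<gamma>' - \<gamma>))"
        by (simp add: algebra_simps)
      \<comment> \<open>Since \<open>t \<ge> 1\<close>, the gain \<open>p\<close> is at least
        \<open>\<gamma>' - \<gamma>\<close>; the loss \<open>3 * e / 2\<close> is at most half of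
        that, and the other half is at least \<open>\<kappa>\<close>.\<close>
      define p where "p = real t * (\<gamma>' - \<gamma>)"
      have "1 * (\<gamma>' - \<gamma>) \<le> p"
        unfolding p_def using t e by (intro mult_right_mono) auto
      then have "3 * e / 2 - p \<le> - \<kappa>"
        using e(3) \<kappa>3 by (simp add: field_simps)
      then have "real n * (3 * e / 2 - real t * (\<gamma>' - \<gamma>)) \<le> real n * - \<kappa>"
        unfolding p_def by (rule mult_left_mono) simp
      with 1 show ?thesis by (simp add: mult.commute)
    qed
    finally show "real m ^ t * exp (real n * (3 * e / 2 - \<gamma>' * real t)) \<le> exp (- \<kappa> * real n)" .
  qed auto
  show ?thesis
    using add_mono[OF add_mono[OF t1 t2] t3] unfolding C_def by (simp only: distrib_right)
qed

text \<open>Each of the finitely many terms of the minimum is continuous in the deviation, so a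
  strict inequality at \<open>\<sigma>\<^sub>a\<close> survives slightly below it. This leaves room
  for the power constraint. The factor \<open>ln b\<close> passes to natural logarithms.\<close>

lemma capacity_slack:
  fixes \<sigma>\<^sub>a \<sigma>\<^sub>z b \<gamma> :: real
  assumes "b > 1" "\<sigma>\<^sub>a > 0" "\<sigma>\<^sub>z > 0" "\<gamma> < capacity b k \<sigma>\<^sub>a \<sigma>\<^sub>z w"
  obtains \<sigma> where "0 < \<sigma>" "\<sigma> < \<sigma>\<^sub>a"
    "\<And>T. T \<noteq> {} \<Longrightarrow> T \<subseteq> {1..k} \<Longrightarrow> \<gamma> * ln b * real (card T) \<le> 1 / 2 * ln (1 + \<sigma>\<^sup>2 / \<sigma>\<^sub>z\<^sup>2 * (\<Sum>j\<in>T. (w j)\<^sup>2))"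
proof -
  let ?P = "{T. T \<noteq> {} \<and> T \<subseteq> {1..k}}"
  let ?f = "\<lambda>T \<sigma>. 1 / (2 * real (card T)) * log b (1 + \<sigma>\<^sup>2 / \<sigma>\<^sub>z\<^sup>2 * (\<Sum>j\<in>T. (w j)\<^sup>2))"
  have fin: "finite ?P" by (rule finite_subset[of _ "Pow {1..k}"]) auto
  have "eventually (\<lambda>\<sigma>. \<gamma> < ?f T \<sigma>) (at_left \<sigma>\<^sub>a)" if T: "T \<in> ?P" for T
  proof -
    have "capacity b k \<sigma>\<^sub>a \<sigma>\<^sub>z w \<le> ?f T \<sigma>\<^sub>a"
      unfolding capacity_def using T fin by (intro Min_le) auto
    with assms(4) have "\<gamma> < ?f T \<sigma>\<^sub>a" by simp
    moreover have "1 + \<sigma>\<^sub>a\<^sup>2 / \<sigma>\<^sub>z\<^sup>2 * (\<Sum>j\<in>T. (w j)\<^sup>2) > 0"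
      by (intro add_pos_nonneg mult_nonneg_nonneg sum_nonneg) auto
    then have "((\<lambda>\<sigma>. ?f T \<sigma>) \<longlongrightarrow> ?f T \<sigma>\<^sub>a) (at_left \<sigma>\<^sub>a)"
      using assms(1,3) by (intro tendsto_intros) auto
    ultimately show ?thesis
      by (rule order_tendstoD(1)[rotated])
  qed
  then have "eventually (\<lambda>\<sigma>. \<forall>T\<in>?P. \<gamma> < ?f T \<sigma>) (at_left \<sigma>\<^sub>a)"
    using fin by (intro eventually_ball_finite) auto
  moreover have "eventually (\<lambda>\<sigma>. \<sigma> \<in> {0<..<\<sigma>\<^sub>a}) (at_left \<sigma>\<^sub>a)"
    by (rule eventually_at_left_real[OF assms(2)])
  ultimately have "eventually (\<lambda>\<sigma>. (\<forall>T\<in>?P. \<gamma> < ?f T \<sigma>) \<and> \<sigma> \<in> {0<..<\<sigma>\<^sub>a}) (at_left \<sigma>\<^sub>a)"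
    by (rule eventually_conj)
  then obtain \<sigma> where \<sigma>: "\<forall>T\<in>?P. \<gamma> < ?f T \<sigma>" "\<sigma> \<in> {0<..<\<sigma>\<^sub>a}"
    using eventually_happens'[OF trivial_limit_at_left_real] by blast
  show ?thesis
  proof (rule that)
    fix T assume T: "T \<noteq> {}" "T \<subseteq> {1..k}"
    then have "card T > 0" using finite_subset by (auto simp: card_gt_0_iff)
    moreover have "\<gamma> < ?f T \<sigma>" using \<sigma>(1) T by auto
    ultimately show "\<gamma> * ln b * real (card T) \<le> 1 / 2 * ln (1 + \<sigma>\<^sup>2 / \<sigma>\<^sub>z\<^sup>2 * (\<Sum>j\<in>T. (w j)\<^sup>2))"
      using assms(1) by (simp add: log_def field_simps)
  qed (use \<sigma>(2) in auto)
qed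

theorem theorem1:
  fixes k :: nat and w :: "nat \<Rightarrow> real" and \<sigma>\<^sub>a \<sigma>\<^sub>z b :: real and n :: "nat \<Rightarrow> nat"
  assumes "k \<ge> 1"
    and "\<forall>i\<in>{1..k}. w i \<noteq> 0"
    and "\<sigma>\<^sub>a > 0" and "\<sigma>\<^sub>z > 0"
    and "b > 1"
    and "\<forall>m\<ge>k. n m > 0"
    and "limsup (\<lambda>m. ereal (log b (real m) / real (n m))) < ereal (capacity b k \<sigma>\<^sub>a \<sigma>\<^sub>z w)"
  shows "\<exists>(A :: nat \<Rightarrow> nat \<Rightarrow> nat \<Rightarrow> real) (d :: nat \<Rightarrow> (nat \<Rightarrow> real) \<Rightarrow> nat set).
    (\<forall>m\<ge>k. d m \<in> recovery_maps (n m) m) \<and>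
    (\<forall>m\<ge>k. 1 / (real (n m) * real m) * (frob_norm (n m) m (A m))\<^sup>2 \<le> \<sigma>\<^sub>a\<^sup>2) \<and>
    (\<lambda>m. avg_error_prob k m (n m) \<sigma>\<^sub>z w (A m) (d m)) \<longlonglongrightarrow> 0"
proof -
  \<comment> \<open>Two thresholds between the upper limit and the capacity:
    \<open>\<gamma>\<^sub>1\<close> will bound the rate for large \<open>m\<close>,
    \<open>\<gamma>\<^sub>2\<close> stays below the capacity, and their gap is spent in the
    exponents.\<close>
  obtain \<gamma>\<^sub>1 where \<gamma>\<^sub>1: "limsup (\<lambda>m. ereal (log b (real m) / real (n m))) < ereal \<gamma>\<^sub>1"
      "\<gamma>\<^sub>1 < capacity b k \<sigma>\<^sub>a \<sigma>\<^sub>z w"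
    using ereal_dense2[OF assms(7)] by auto
  then obtain \<gamma>\<^sub>2 where \<gamma>\<^sub>2: "\<gamma>\<^sub>1 < \<gamma>\<^sub>2" "\<gamma>\<^sub>2 < capacity b k \<sigma>\<^sub>a \<sigma>\<^sub>z w"
    using dense by blast
  obtain \<sigma> where \<sigma>: "0 < \<sigma>" "\<sigma> < \<sigma>\<^sub>a"
    and cap: "\<And>T. T \<noteq> {} \<Longrightarrow> T \<subseteq> {1..k} \<Longrightarrow>
      \<gamma>\<^sub>2 * ln b * real (card T) \<le> 1 / 2 * ln (1 + \<sigma>\<^sup>2 / \<sigma>\<^sub>z\<^sup>2 * (\<Sum>j\<in>T. (w j)\<^sup>2))"
    using capacity_slack[OF assms(5,3,4) \<gamma>\<^sub>2(2)] by blast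
  define \<gamma> where "\<gamma> = \<gamma>\<^sub>1 * ln b"
  define \<gamma>' where "\<gamma>' = \<gamma>\<^sub>2 * ln b"
  have lnb: "ln b > 0" using assms(5) by simp
  have gap: "\<gamma> < \<gamma>'" using \<gamma>\<^sub>2(1) lnb by (simp add: \<gamma>_def \<gamma>'_def)
  define e where "e = min (1 / 2) ((\<gamma>' - \<gamma>) / 3)"
  have e: "0 < e" "e \<le> 1 / 2" "3 * e \<le> \<gamma>' - \<gamma>"
    using gap by (auto simp: e_def min_def)
  define C where "C = 1 + real (card ((\<lambda>(x, y). x - y) ` (insert 0 (w ` {1..k}) \<times> insert 0 (w ` {1..k}))) ^ k)
      + real (2 ^ k * k ^ k)"
  define \<kappa> where "\<kappa> = min (e\<^sup>2 / 16) ((\<gamma>' - \<gamma>) / 2)"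
  have \<kappa>: "\<kappa> > 0" using e gap by (simp add: \<kappa>_def)
  have C: "C > 0" unfolding C_def by (intro add_pos_nonneg) auto
  define d where "d m = support_decoder k m (n m) w (real (n m) * ((1 + e) * \<sigma>\<^sub>z\<^sup>2))" for m
  define E where "E m = 2 * (C * exp (- \<kappa> * real (n m))) / (1 - \<sigma>\<^sup>2 / \<sigma>\<^sub>a\<^sup>2)" for m
  \<comment> \<open>The power constraint must hold for every \<open>m \<ge> k\<close>, the error
    bound only where the rate is already below \<open>\<gamma>\<close>; elsewhere the zero matrix
    serves.\<close>
  have "\<exists>A. 1 / (real (n m) * real m) * (frob_norm (n m) m A)\<^sup>2 \<le> \<sigma>\<^sub>a\<^sup>2 \<and>
      (ln (real m) \<le> real (n m) * \<gamma> \<longrightarrow> avg_error_prob k m (n m) \<sigma>\<^sub>z w A (d m A) \<le> E m)" if m: "m \<ge> k" for m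
  proof (cases "ln (real m) \<le> real (n m) * \<gamma>")
    case True
    have m0: "m > 0" "n m > 0" using m assms(1,6) by auto
    have bound: "exp (- e\<^sup>2 / 16) ^ n m + real (card (patterns k m w S)) * exp (- e\<^sup>2 / 8) ^ n m
      + (\<Sum>S'\<in>{S' \<in> distinct_tuples k m. S' ` {1..k} \<noteq> S ` {1..k}}.
        exp ((e - ln (1 - e) - ln (output_variance \<sigma> \<sigma>\<^sub>z (S ` {1..k}) (signal_diff k w S S') / \<sigma>\<^sub>z\<^sup>2)) / 2) ^ n m)
      \<le> C * exp (- \<kappa> * real (n m))" if "S \<in> distinct_tuples k m" for S
      unfolding C_def \<kappa>_def
      by (rule random_coding_bound_le[OF that m0(1) assms(4) e True cap[folded \<gamma>'_def]])
    have "e < 1" "C * exp (- \<kappa> * real (n m)) > 0" using e(2) C by auto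
    from exists_good_matrix[OF assms(2) m m0 \<sigma> assms(4) e(1) this bound] show ?thesis
      unfolding d_def E_def by blast
  next
    case False
    have "frob_norm (n m) m (\<lambda>_ _. 0) = 0" by (simp add: frob_norm_def L2_set_def)
    with False show ?thesis by (intro exI[of _ "\<lambda>_ _. 0"]) simp
  qed
  then obtain A where A: "\<And>m. m \<ge> k \<Longrightarrow> 1 / (real (n m) * real m) * (frob_norm (n m) m (A m))\<^sup>2 \<le> \<sigma>\<^sub>a\<^sup>2"
      "\<And>m. m \<ge> k \<Longrightarrow> ln (real m) \<le> real (n m) * \<gamma> \<Longrightarrow> avg_error_prob k m (n m) \<sigma>\<^sub>z w (A m) (d m (A m)) \<le> E m"
    by metis
  have rate: "eventually (\<lambda>m. ln (real m) \<le> real (n m) * \<gamma>) sequentially"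
    using Limsup_lessD[OF \<gamma>\<^sub>1(1)] eventually_ge_at_top[of k]
  proof eventually_elim
    case (elim m)
    then have "n m > 0" using assms(6) by simp
    with elim(1) lnb show ?case by (simp add: \<gamma>_def log_def field_simps)
  qed
  \<comment> \<open>Positivity comes from the rate bound itself, because \<open>ln m > 0\<close> for
    \<open>m \<ge> 2\<close>. It makes \<open>n m \<ge> ln m / \<gamma>\<close> force
    \<open>n m\<close> to infinity, and with it the error bound \<open>E\<close> to zero.\<close>
  have "\<gamma> > 0"
  proof -
    obtain m where "ln (real m) \<le> real (n m) * \<gamma>" "m \<ge> 2"
      using eventually_happens'[OF sequentially_bot eventually_conj[OF rate eventually_ge_at_top[of 2]]] by blast
    then have "0 < real (n m) * \<gamma>"
      using ln_gt_zero[of "real m"] by linarith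
    then show ?thesis by (simp add: zero_less_mult_iff)
  qed
  have "filterlim (\<lambda>m. ln (real m) / \<gamma>) at_top sequentially"
    using \<open>\<gamma> > 0\<close> by real_asymp
  then have n_lim: "filterlim (\<lambda>m. real (n m)) at_top sequentially"
    by (rule filterlim_at_top_mono) (use rate \<open>\<gamma> > 0\<close> in \<open>auto elim!: eventually_mono simp: field_simps\<close>)
  have "filterlim (\<lambda>m. \<kappa> * real (n m)) at_top sequentially"
    using \<kappa> by (intro filterlim_tendsto_pos_mult_at_top[OF tendsto_const _ n_lim])
  then have "(\<lambda>m. exp (- (\<kappa> * real (n m)))) \<longlonglongrightarrow> 0"
    by (intro filterlim_compose[OF exp_at_bot] filterlim_compose[OF filterlim_uminus_at_bot_at_top])
  then have "(\<lambda>m. 2 * C / (1 - \<sigma>\<^sup>2 / \<sigma>\<^sub>a\<^sup>2) * exp (- (\<kappa> * real (n m)))) \<longlonglongrightarrow> 0"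
    by (rule tendsto_mult_right_zero)
  then have E_lim: "E \<longlonglongrightarrow> 0"
    unfolding E_def by (simp add: mult.assoc)
  have "(\<lambda>m. avg_error_prob k m (n m) \<sigma>\<^sub>z w (A m) (d m (A m))) \<longlonglongrightarrow> 0"
  proof (rule tendsto_sandwich[OF _ _ tendsto_const E_lim])
    show "eventually (\<lambda>m. 0 \<le> avg_error_prob k m (n m) \<sigma>\<^sub>z w (A m) (d m (A m))) sequentially"
      by (simp add: avg_error_prob_def)
    show "eventually (\<lambda>m. avg_error_prob k m (n m) \<sigma>\<^sub>z w (A m) (d m (A m)) \<le> E m) sequentially"
      using rate eventually_ge_at_top[of k] by eventually_elim (rule A(2))
  qed
  then show ?thesis
    using A(1) support_decoder_in_recovery_maps unfolding d_def
    by (intro exI[of _ A] exI[of _ "\<lambda>m. d m (A m)"]) (simp add: d_def)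
qed

end
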